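(* Let $r\in\mathbb{N}$, $\mathbf{m}=(m_1,\dots,m_r)\in\mathbb{N}^r$, $m=m_1+\cdots+m_r$, $\mathbf{f}\in\mathbb{C}^r$, $a,b,c,d,e,g,h\in\mathbb{C}$, $n\in\mathbb{N}$, and put $\lambda=c-a-b-m$. Suppose that $(1+a+b-c)_m\ne0$, $(c-a-m)_m\ne0$, $(c-b-m)_m\ne0$ and $g+e+n-d+\lambda=2$. Then $$ F\left(\begin{matrix} -n,a,b,d,h+1,\mathbf{f}+\mathbf{m} \\ c,g,e,h,\mathbf{f} \end{matrix}\right) =\Omega\cdot F\left(\begin{matrix} -n,\;d,\;a+\lambda,\;b+\lambda,\;\mu+1,\;\hat{\boldsymbol\zeta}+1 \\ g+\lambda,\;e+\lambda,\;c,\;\mu,\;\hat{\boldsymbol\zeta} \end{matrix}\right), $$ where $$ \Omega=\frac{(g+\lambda)_{n-1}(e+\lambda)_{n-1}}{h\,(g)_{n}(e)_{n}}\bigl(nd(h+\lambda)+h(g+\lambda-1)(e+\lambda-1)\bigr), $$ $$ \mu=\frac{nd(h+\lambda)+h(g+\lambda-1)(e+\lambda-1)}{\lambda(h-g+1)-(g+n-1)(g-d-1)}, $$ and $\hat{\boldsymbol\zeta}=(\zeta_1,\dots,\zeta_m)$ is the vector of zeros of the polynomial $\hat{Q}_m(a,b,c,\mathbf{f},\mathbf{m};t)$ (defined in the context). The hypergeometric functions on both sides are Saalschützian, i.e. the sum of the lower parameters minus the sum of the upper parameters equals $1$.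
   Context: Notation: $(a)_n=\Gamma(a+n)/\Gamma(a)$; for vectors $(\mathbf{a})_n=\prod_j(a_j)_n$, and $\mathbf{a}+\beta$ means adding $\beta$ to each component. $F\left(\begin{smallmatrix} \mathbf{a} \\ \mathbf{b} \end{smallmatrix}\right)=\sum_{k\ge0}\frac{(\mathbf{a})_k}{(\mathbf{b})_k k!}$ is the generalized hypergeometric series at unit argument. Standing convention: lower parameters are never non-positive integers, and denominators occurring in the formulas do not vanish. $$ \hat{Q}_m(a,b,c,\mathbf{f},\mathbf{m};t)=\sum_{k=0}^{m}\frac{{}_{r+1}F_{r}(-k,\mathbf{f}+\mathbf{m};\mathbf{f}\,|\,1)\,(a)_k(b)_k(t)_k}{(c-a-m)_k(c-b-m)_k\,k!}\;{}_{3}F_{2}\left(\begin{matrix} -m+k,\;t+k,\;c-a-b-m \\ c-a-m+k,\;c-b-m+k \end{matrix}\,\Big|\,1\right). $$ Zeros are listed with multiplicity; as implicit in the notation $(\zeta_1,\dots,\zeta_m)$, $\hat{Q}_m$ is taken to have exact degree $m$. *)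

theory Defs
  imports "HOL-Analysis.Analysis"
begin

text \<open>
  Generalized hypergeometric series at unit argument; the last argument of
  \<^const>\<open>fps_hypergeo\<close> is a scale factor for the variable.
\<close>

definition hypergeo1 :: "complex list \<Rightarrow> complex list \<Rightarrow> complex" where
  "hypergeo1 as bs = (\<Sum>k. fps_nth (fps_hypergeo as bs 1) k)"

lemma hypergeo1_altdef:
  "hypergeo1 as bs =
     (\<Sum>k. (\<Prod>a\<leftarrow>as. pochhammer a k) / ((\<Prod>b\<leftarrow>bs. pochhammer b k) * fact k))"
proof -
  have "foldl (\<lambda>r a. r * pochhammer a k) x as = x * (\<Prod>a\<leftarrow>as. pochhammer a k)"
    for x :: complex and k and as :: "complex list"
    by (induction as arbitrary: x) (simp_all add: mult.assoc)
  then show ?thesis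
    by (simp add: hypergeo1_def mult_ac)
qed

text \<open>
  The sum of the lower parameters exceeds that of the upper ones by one. The implicit
  lower parameter 1 coming from \<open>k!\<close> is not counted.
\<close>

definition saalschutzian :: "complex list \<Rightarrow> complex list \<Rightarrow> bool" where
  "saalschutzian as bs \<longleftrightarrow> sum_list bs - sum_list as = 1"

text \<open>
  The quotient \<open>\<Gamma>(x + k) / \<Gamma>(x)\<close> for integer \<open>k\<close>. Negative \<open>k\<close> are admitted because
  \<open>(x)\<^bsub>n-1\<^esub>\<close> with \<open>n = 0\<close> has to mean \<open>1 / (x - 1)\<close>.
\<close>

definition rising :: "complex \<Rightarrow> int \<Rightarrow> complex" where
  "rising x k =
     (if k \<ge> 0 then pochhammer x (nat k)
      else 1 / pochhammer (x + of_int k) (nat (- k)))"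

lemma rising_Gamma:
  assumes "x \<notin> \<int>\<^sub>\<le>\<^sub>0" "x + of_int k \<notin> \<int>\<^sub>\<le>\<^sub>0"
  shows   "rising x k = Gamma (x + of_int k) / Gamma x"
  using assms by (auto simp: rising_def pochhammer_Gamma)

definition Qhat ::
  "nat \<Rightarrow> complex \<Rightarrow> complex \<Rightarrow> complex \<Rightarrow> complex list \<Rightarrow> nat list \<Rightarrow> complex \<Rightarrow> complex"
where
  "Qhat m a b c f ms t =
     (\<Sum>k\<le>m.
        hypergeo1 (- of_nat k # map2 (\<lambda>x j. x + of_nat j) f ms) f *
          pochhammer a k * pochhammer b k * pochhammer t k /
        (pochhammer (c - a - of_nat m) k * pochhammer (c - b - of_nat m) k * fact k) *
        hypergeo1
          [- of_nat m + of_nat k, t + of_nat k, c - a - b - of_nat m]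
          [c - a - of_nat m + of_nat k, c - b - of_nat m + of_nat k])"

lemma hypergeo1_terminating:
  "hypergeo1 (- of_nat n # as) bs =
     (\<Sum>k\<le>n. pochhammer (- of_nat n) k * (\<Prod>a\<leftarrow>as. pochhammer a k) /
                ((\<Prod>b\<leftarrow>bs. pochhammer b k) * fact k))"
  unfolding hypergeo1_altdef
  by (subst suminf_finite[of "{..n}"]) (auto simp: pochhammer_of_nat_eq_0_iff)

lemma Qhat_is_poly: "\<exists>P. \<forall>t. poly P t = Qhat m a b c f ms t"
proof -
  define T where "T = {F :: complex \<Rightarrow> complex. \<exists>P. \<forall>t. poly P t = F t}"
  have const: "(\<lambda>_. x) \<in> T" for x
    unfolding T_def by (auto intro: exI[of _ "[:x:]"])
  have mult: "(\<lambda>t. F t * G t) \<in> T" if "F \<in> T" "G \<in> T" for F G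
    using that unfolding T_def by simp (metis poly_mult)
  have sum: "(\<lambda>t. \<Sum>i\<in>A. F i t) \<in> T" if "\<And>i. i \<in> A \<Longrightarrow> F i \<in> T" for A :: "nat set" and F
  proof -
    from that have "\<forall>i\<in>A. \<exists>P. \<forall>t. poly P t = F i t"
      unfolding T_def by blast
    then obtain P where "\<forall>i\<in>A. \<forall>t. poly (P i) t = F i t"
      by metis
    then show ?thesis
      unfolding T_def by (auto intro!: exI[of _ "\<Sum>i\<in>A. P i"] simp: poly_sum)
  qed
  have divide: "(\<lambda>t. F t / x) \<in> T" if "F \<in> T" for F x
    using mult[OF that const[of "inverse x"]] by (simp add: divide_inverse)
  have poch: "(\<lambda>t. pochhammer (t + x) k) \<in> T" for x k
    unfolding T_def
    by (auto intro!: exI[of _ "\<Prod>i<k. [:x + of_nat i, 1:]"]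
             simp: poly_prod pochhammer_prod atLeast0LessThan add_ac)
  have poch0: "(\<lambda>t. pochhammer t k) \<in> T" for k
    using poch[of 0 k] by simp
  have inner: "(\<lambda>t. hypergeo1 [- of_nat m + of_nat k, t + x, y] bs) \<in> T" if "k \<le> m" for k x y bs
  proof -
    have "- of_nat m + of_nat k = - (of_nat (m - k) :: complex)"
      using that by (simp add: of_nat_diff)
    then show ?thesis
      unfolding hypergeo1_terminating
      by (simp only: hypergeo1_terminating list.map prod_list.Cons prod_list.Nil mult_1_right)
         (intro sum mult divide const poch)
  qed
  have "(\<lambda>t. Qhat m a b c f ms t) \<in> T"
    unfolding Qhat_def by (intro sum mult divide const poch0 inner) auto
  then show ?thesis
    by (simp add: T_def)
qed

end

theory Submission
  imports Defs "HOL-Computational_Algebra.Fundamental_Theorem_Algebra"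
begin

text \<open>
  Expanding the quotient \<open>(f + m)\<^sub>k / (f)\<^sub>k\<close>, a polynomial of degree \<open>m\<close> in \<open>k\<close>, in the binomials
  \<open>k choose s\<close> turns the power series with coefficients
  \<open>(a)\<^sub>k (b)\<^sub>k (f + m)\<^sub>k / ((c)\<^sub>k (f)\<^sub>k k!)\<close> into a combination of shifted Gauss series. Euler's
  transformation and multiplication by the polynomial \<open>(1 - X)^(m - s)\<close> then give the second
  Miller-Paris transformation: that series is \<open>(1 - X)^\<lambda>\<close> times the series with coefficients
  \<open>(a + \<lambda>)\<^sub>j (b + \<lambda>)\<^sub>j Qhat(-j) / ((c)\<^sub>j j!)\<close>, and \<open>Qhat(-j)\<close> is the product of the
  \<open>(\<zeta> + 1)\<^sub>j / (\<zeta>)\<^sub>j\<close>. Comparing coefficients and summing them against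
  \<open>(-n)\<^sub>k (d)\<^sub>k (h + 1)\<^sub>k / ((g)\<^sub>k (e)\<^sub>k (h)\<^sub>k)\<close> leaves for each \<open>j\<close> a Saalschuetzian inner sum,
  whose closed form is the \<open>j\<close>-dependent factor on the right times \<open>\<Omega>\<close>.
\<close>

section \<open>Binomial sums and Pochhammer symbols\<close>

text \<open>Pascal's rule. It brings a sum over row \<open>Suc N\<close> to row \<open>N\<close>,
  where the inductions on the row can compare summands one by one.\<close>

lemma sum_binomial_Suc:
  fixes T :: "nat \<Rightarrow> 'a::comm_ring_1"
  shows "(\<Sum>k\<le>Suc N. of_nat (Suc N choose k) * T k) =
         (\<Sum>k\<le>N. of_nat (N choose k) * (T k + T (Suc k)))"
proof -
  have "(\<Sum>k\<le>Suc N. of_nat (Suc N choose k) * T k) =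
        T 0 + (\<Sum>k\<le>N. of_nat (N choose Suc k) * T (Suc k)) + (\<Sum>k\<le>N. of_nat (N choose k) * T (Suc k))"
    by (simp add: sum.atMost_Suc_shift ring_distribs sum.distrib del: sum.atMost_Suc)
  also have "T 0 + (\<Sum>k\<le>N. of_nat (N choose Suc k) * T (Suc k)) = (\<Sum>k\<le>Suc N. of_nat (N choose k) * T k)"
    by (simp add: sum.atMost_Suc_shift del: sum.atMost_Suc)
  also have "\<dots> = (\<Sum>k\<le>N. of_nat (N choose k) * T k)"
    by (simp add: binomial_eq_0)
  finally show ?thesis
    by (simp add: ring_distribs sum.distrib)
qed

text \<open>Subtracting in the ring instead of on \<open>nat\<close> keeps the absorption identity
  valid for \<open>k > N\<close>, where both binomials vanish.\<close>

lemma of_nat_Suc_times_binomial_Suc: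
  "of_nat (Suc k) * of_nat (N choose Suc k) = ((of_nat N - of_nat k) * of_nat (N choose k) :: 'a::comm_ring_1)"
proof (cases "k \<le> N")
  case True
  have "Suc k * (N choose Suc k) = (N - k) * (N choose k)"
    by (simp only: binomial_absorption binomial_absorb_comp)
  then show ?thesis
    using True by (metis of_nat_diff of_nat_mult)
qed (simp add: binomial_eq_0)

lemma plus_of_nat_notin_nonpos_Ints:
  "x \<notin> \<int>\<^sub>\<le>\<^sub>0 \<Longrightarrow> x + of_nat k \<notin> \<int>\<^sub>\<le>\<^sub>0"
  by (metis add_diff_cancel_right' nonpos_Ints_diff_Nats of_nat_in_Nats)

lemma pochhammer_nonzero:
  fixes x :: "'a::field_char_0"
  shows "x \<notin> \<int>\<^sub>\<le>\<^sub>0 \<Longrightarrow> pochhammer x k \<noteq> 0"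
  by (auto simp: pochhammer_eq_0_iff)

text \<open>Both sides are \<open>pochhammer (x + of_nat k) (Suc (N - k))\<close>, split at its
  first and at its last factor.\<close>

lemma pochhammer_rec_shift:
  fixes x :: "'a::comm_ring_1"
  assumes "k \<le> N"
  shows "(x + of_nat k) * pochhammer (x + of_nat (Suc k)) (N - k) =
         pochhammer (x + of_nat k) (N - k) * (x + of_nat N)"
  using pochhammer_rec[of "x + of_nat k" "N - k"] pochhammer_rec'[of "x + of_nat k" "N - k"] assms
  by (simp add: of_nat_diff algebra_simps)

section \<open>Saalschuetz's summation theorem\<close>

text \<open>
  Zeilberger's method in the index \<open>N\<close>; the certificate is the function \<open>G\<close> below.
\<close>
lemma saalschuetz_binomial:
  fixes A B C :: "'a::field_char_0"
  assumes C: "C \<notin> \<int>\<^sub>\<le>\<^sub>0"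
  shows "(\<Sum>k\<le>N. of_nat (N choose k) * (pochhammer A k * pochhammer B k *
            pochhammer (C + of_nat k) (N - k) * pochhammer (C - A - B) (N - k))) =
         pochhammer (C - A) N * pochhammer (C - B) N"
proof (induction N)
  case 0
  then show ?case by simp
next
  case (Suc N)
  define E where "E = C - A - B"
  define T where "T N k = pochhammer A k * pochhammer B k *
    pochhammer (C + of_nat k) (N - k) * pochhammer E (N - k)" for N k
  \<comment> \<open>For \<open>k \<le> N\<close>, the terms \<open>T (Suc N) k\<close>,
    \<open>T (Suc N) (Suc k)\<close> and \<open>(C + of_nat N) * T N k\<close> are polynomial
    multiples of \<open>Y k\<close>, so the recurrence reduces to a polynomial identity.\<close>
  define Y where "Y k = pochhammer A k * pochhammer B k *
    pochhammer (C + of_nat (Suc k)) (N - k) * pochhammer E (N - k)" for k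
  define G where "G k = of_nat (k * (N choose k)) * Y k * (E + of_nat N - of_nat k) * (C + of_nat k)" for k
  have CN: "C + of_nat N \<noteq> 0"
    using C plus_of_nat_eq_0_imp by blast
  have T_N: "(C + of_nat N) * T N k = (C + of_nat k) * Y k" if "k \<le> N" for k
    using pochhammer_rec_shift[OF that, of C] by (simp add: T_def Y_def)
  have T_Suc: "T (Suc N) k + T (Suc N) (Suc k) =
      Y k * ((C + of_nat k) * (E + of_nat N - of_nat k) + (A + of_nat k) * (B + of_nat k))"
    if "k \<le> N" for k
  proof -
    have "T (Suc N) k = Y k * ((C + of_nat k) * (E + of_nat N - of_nat k))"
    proof -
      have "pochhammer (C + of_nat k) (Suc N - k) =
          (C + of_nat k) * pochhammer (C + of_nat (Suc k)) (N - k)"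
        using that by (simp add: Suc_diff_le pochhammer_rec add.commute add.left_commute)
      moreover have "pochhammer E (Suc N - k) = pochhammer E (N - k) * (E + of_nat N - of_nat k)"
        using that by (simp add: Suc_diff_le pochhammer_Suc of_nat_diff add_diff_eq)
      ultimately show ?thesis
        by (simp only: T_def Y_def mult_ac)
    qed
    moreover have "T (Suc N) (Suc k) = Y k * ((A + of_nat k) * (B + of_nat k))"
      by (simp add: T_def Y_def pochhammer_Suc)
    ultimately show ?thesis by (simp add: algebra_simps)
  qed
  have G_Suc: "G (Suc k) = of_nat (N choose k) * Y k * of_nat (N - k) * (A + of_nat k) * (B + of_nat k)"
    if kN: "k \<le> N" for k
  \<comment> \<open>The truncated exponent \<open>N - Suc k\<close> in \<open>Y (Suc k)\<close> is
    faithful only for \<open>k < N\<close>; at \<open>k = N\<close> both sides vanish.\<close>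
  proof (cases "k = N")
    case False
    then obtain j where j: "N = Suc (k + j)"
      using kN less_imp_Suc_add[of k N] by auto
    have b: "of_nat (Suc k * (N choose Suc k)) = (of_nat (N choose k) * of_nat (N - k) :: 'a)"
      using of_nat_Suc_times_binomial_Suc[of k N, where ?'a = 'a] kN
      by (simp only: of_nat_mult of_nat_diff mult.commute)
    have Y': "Y (Suc k) * (E + of_nat N - of_nat (Suc k)) * (C + of_nat (Suc k)) =
      Y k * (A + of_nat k) * (B + of_nat k)"
      using pochhammer_rec[of "C + of_nat (Suc k)" j] pochhammer_rec'[of E j]
      by (simp add: Y_def j pochhammer_Suc algebra_simps)
    show ?thesis
      unfolding G_def b using Y' by (simp add: mult.assoc mult.left_commute)
  qed (simp add: G_def binomial_eq_0)
  have step: "(C + of_nat N) * (of_nat (N choose k) * (T (Suc N) k + T (Suc N) (Suc k))) =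
      (C - A + of_nat N) * (C - B + of_nat N) * ((C + of_nat N) * (of_nat (N choose k) * T N k)) +
      (G (Suc k) - G k)" if "k \<le> N" for k
  proof -
    have *: "(C + of_nat N) * (of_nat (N choose k) * T N k) = of_nat (N choose k) * ((C + of_nat k) * Y k)"
      using T_N[OF that] by (simp add: mult.left_commute)
    show ?thesis
      unfolding * T_Suc[OF that] G_Suc[OF that] unfolding G_def E_def
      using that by (simp add: of_nat_diff) algebra
  qed
  have "(C + of_nat N) * (\<Sum>k\<le>Suc N. of_nat (Suc N choose k) * T (Suc N) k) =
     (\<Sum>k\<le>N. (C + of_nat N) * (of_nat (N choose k) * (T (Suc N) k + T (Suc N) (Suc k))))"
    by (simp only: sum_binomial_Suc sum_distrib_left)
  also have "\<dots> = (\<Sum>k\<le>N. (C - A + of_nat N) * (C - B + of_nat N) *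
        ((C + of_nat N) * (of_nat (N choose k) * T N k)) + (G (Suc k) - G k))"
    by (intro sum.cong step) auto
  also have "\<dots> = (C - A + of_nat N) * (C - B + of_nat N) *
        ((C + of_nat N) * (\<Sum>k\<le>N. of_nat (N choose k) * T N k)) + (\<Sum>k\<le>N. G (Suc k) - G k)"
    by (simp only: sum.distrib sum_distrib_left)
  \<comment> \<open>\<open>G\<close> vanishes at 0 through its factor \<open>k\<close> and at
    \<open>Suc N\<close> through its binomial.\<close>
  also have "(\<Sum>k\<le>N. G (Suc k) - G k) = 0"
    unfolding lessThan_Suc_atMost[symmetric] sum_lessThan_telescope by (simp add: G_def binomial_eq_0)
  also have "(\<Sum>k\<le>N. of_nat (N choose k) * T N k) = pochhammer (C - A) N * pochhammer (C - B) N"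
    using Suc.IH by (simp add: T_def E_def)
  finally have "(C + of_nat N) * (\<Sum>k\<le>Suc N. of_nat (Suc N choose k) * T (Suc N) k) =
      (C + of_nat N) * (pochhammer (C - A) (Suc N) * pochhammer (C - B) (Suc N))"
    by (simp add: pochhammer_Suc mult_ac del: sum.atMost_Suc)
  with CN have "(\<Sum>k\<le>Suc N. of_nat (Suc N choose k) * T (Suc N) k) =
      pochhammer (C - A) (Suc N) * pochhammer (C - B) (Suc N)"
    by (metis mult_cancel_left)
  then show ?case
    by (simp only: T_def E_def)
qed

lemma pochhammer_minus_of_nat_div_fact:
  "pochhammer (- of_nat N) k / fact k = ((-1) ^ k * of_nat (N choose k) :: 'a::field_char_0)"
  by (simp add: binomial_gbinomial gbinomial_pochhammer)

text \<open>The Pfaff-Saalschuetz theorem. Multiplied by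
  \<open>pochhammer C N * pochhammer D N\<close>, its summands are up to sign those of the
  division-free \<open>saalschuetz_binomial\<close>.\<close>

lemma saalschuetz:
  fixes A B C D :: "'a::field_char_0"
  assumes C: "C \<notin> \<int>\<^sub>\<le>\<^sub>0" and D: "D \<notin> \<int>\<^sub>\<le>\<^sub>0" and bal: "C + D = 1 + A + B - of_nat N"
  shows "(\<Sum>k\<le>N. pochhammer (- of_nat N) k * pochhammer A k * pochhammer B k /
            (pochhammer C k * pochhammer D k * fact k)) =
         pochhammer (C - B) N * pochhammer (D - B) N / (pochhammer C N * pochhammer D N)"
proof -
  note nz = pochhammer_nonzero[OF C] pochhammer_nonzero[OF D]
  \<comment> \<open>The balance condition puts both parameters into the form in which
    \<open>pochhammer_minus\<close> reflects them, to the bases \<open>D + of_nat k\<close> and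
    \<open>D - B\<close>.\<close>
  have CAB: "C - A - B = - (D + of_nat N - 1)" and CA: "C - A = - (D - B + of_nat N - 1)"
    using bal by (simp_all add: algebra_simps)
  have "pochhammer C N * pochhammer D N *
      (pochhammer (- of_nat N) k * pochhammer A k * pochhammer B k /
            (pochhammer C k * pochhammer D k * fact k)) =
      (-1) ^ N * (of_nat (N choose k) * (pochhammer A k * pochhammer B k *
            pochhammer (C + of_nat k) (N - k) * pochhammer (C - A - B) (N - k)))"
    (is "?L = ?R") if "k \<le> N" for k
  proof -
    have *: "pochhammer (C - A - B) (N - k) = (-1) ^ (N - k) * pochhammer (D + of_nat k) (N - k)"
      using that unfolding CAB pochhammer_minus by (simp add: of_nat_diff)
    have "?R = ((-1) ^ N * (-1) ^ (N - k)) * of_nat (N choose k) * (pochhammer A k * pochhammer B k) *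
         (pochhammer (C + of_nat k) (N - k) * pochhammer (D + of_nat k) (N - k))"
      unfolding * by (simp only: mult_ac)
    also have "(-1) ^ N * (-1) ^ (N - k) = ((-1) ^ k :: 'a)"
      using that by (simp add: minus_one_power_iff)
    also have "(-1) ^ k * of_nat (N choose k) * (pochhammer A k * pochhammer B k) *
         (pochhammer (C + of_nat k) (N - k) * pochhammer (D + of_nat k) (N - k)) = pochhammer (- of_nat N) k / fact k * (pochhammer A k * pochhammer B k) *
         (pochhammer (C + of_nat k) (N - k) * pochhammer (D + of_nat k) (N - k))"
      by (simp only: pochhammer_minus_of_nat_div_fact)
    also have "\<dots> = ?L"
      unfolding pochhammer_product[OF that, of C] pochhammer_product[OF that, of D]
      using nz by (simp add: field_simps)
    finally show ?thesis ..
  qed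
  then have "pochhammer C N * pochhammer D N *
      (\<Sum>k\<le>N. pochhammer (- of_nat N) k * pochhammer A k * pochhammer B k /
            (pochhammer C k * pochhammer D k * fact k)) =
      (-1) ^ N * (pochhammer (C - A) N * pochhammer (C - B) N)"
    unfolding saalschuetz_binomial[OF C, symmetric] sum_distrib_left
    by (intro sum.cong) auto
  also have "\<dots> = pochhammer (C - B) N * pochhammer (D - B) N"
    unfolding CA pochhammer_minus by (simp add: mult_ac)
  finally show ?thesis
    using nz by (simp add: field_simps)
qed

section \<open>The binomial series and Euler's transformation\<close>

text \<open>\<open>fps_hypergeo [x] [] 1\<close> is the power \<open>(1 - X)^(-x)\<close>, so
  exponents add; coefficientwise this is the Chu-Vandermonde convolution.\<close>

lemma fps_hypergeo_power_add:
  "fps_hypergeo [x] [] 1 * fps_hypergeo [y] [] 1 = (fps_hypergeo [x + y] [] 1 :: 'a::field_char_0 fps)"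
proof (rule fps_ext)
  fix N
  have "pochhammer (x + y) N / fact N =
      (\<Sum>k\<le>N. pochhammer x k / fact k * (pochhammer y (N - k) / fact (N - k)))"
    unfolding pochhammer_binomial_sum sum_divide_distrib
    by (intro sum.cong) (auto simp: binomial_fact)
  then show "fps_nth (fps_hypergeo [x] [] 1 * fps_hypergeo [y] [] 1) N = fps_nth (fps_hypergeo [x + y] [] 1) N"
    by (simp add: fps_mult_nth atMost_atLeast0)
qed

lemma fps_hypergeo_power_0: "fps_hypergeo [0] [] 1 = (1 :: 'a::field_char_0 fps)"
  by (rule fps_ext) (simp add: pochhammer_0_left)

lemma fps_hypergeo_power_minus_1: "fps_hypergeo [-1] [] 1 = (1 - fps_X :: 'a::field_char_0 fps)"
proof (rule fps_ext)
  fix N :: nat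
  consider "N = 0" | "N = 1" | "N > 1" by linarith
  then show "fps_nth (fps_hypergeo [-1] [] 1) N = fps_nth (1 - fps_X :: 'a fps) N"
    using pochhammer_of_nat_eq_0_lemma[of 1 N, where ?'a = 'a] by cases auto
qed

text \<open>The \<open>N\<close>-th coefficients agree by \<open>saalschuetz_binomial\<close>
  divided by \<open>pochhammer C N * fact N\<close>; the prefactor is
  \<open>(1 - X)^(A + B - C)\<close>.\<close>

lemma euler_transformation:
  fixes A B C :: "'a::field_char_0"
  assumes C: "C \<notin> \<int>\<^sub>\<le>\<^sub>0"
  shows "fps_hypergeo [C - A - B] [] 1 * fps_hypergeo [A, B] [C] 1 = fps_hypergeo [C - A, C - B] [C] 1"
proof (rule fps_ext)
  fix N
  note nz = pochhammer_nonzero[OF C]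
  have "fps_nth (fps_hypergeo [C - A, C - B] [C] 1) N =
      (\<Sum>k\<le>N. of_nat (N choose k) * (pochhammer A k * pochhammer B k *
            pochhammer (C + of_nat k) (N - k) * pochhammer (C - A - B) (N - k)) /
            (pochhammer C N * fact N))"
    by (simp add: saalschuetz_binomial[OF C] sum_divide_distrib[symmetric])
  also have "\<dots> = (\<Sum>k\<le>N. fps_nth (fps_hypergeo [A, B] [C] 1) k * fps_nth (fps_hypergeo [C - A - B] [] 1) (N - k))"
  proof (intro sum.cong refl)
    fix k assume "k \<in> {..N}"
    then have k: "k \<le> N" by simp
    show "of_nat (N choose k) * (pochhammer A k * pochhammer B k *
            pochhammer (C + of_nat k) (N - k) * pochhammer (C - A - B) (N - k)) /
            (pochhammer C N * fact N) =
          fps_nth (fps_hypergeo [A, B] [C] 1) k * fps_nth (fps_hypergeo [C - A - B] [] 1) (N - k)"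
      using nz[of N] nz[of k] unfolding pochhammer_product[OF k, of C]
      by (simp add: binomial_fact[OF k] field_simps)
  qed
  finally show "fps_nth (fps_hypergeo [C - A - B] [] 1 * fps_hypergeo [A, B] [C] 1) N =
      fps_nth (fps_hypergeo [C - A, C - B] [C] 1) N"
    by (simp only: mult.commute[of "fps_hypergeo [C - A - B] [] 1"] fps_mult_nth atMost_atLeast0)
qed

section \<open>Multiplication of a Gauss series by a power of \<open>1 - X\<close>\<close>

text \<open>
  By induction on \<open>M\<close>, multiplying by one factor \<open>1 - X\<close> at a time. The induction step is the
  contiguous relation \<open>contig\<close>, after which the sums differ by a telescoping one.
\<close>
lemma gauss_times_power_nth:
  fixes \<alpha> \<beta> \<gamma> :: "'a::field_char_0"
  assumes \<gamma>: "\<gamma> \<notin> \<int>\<^sub>\<le>\<^sub>0"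
  shows "fps_nth (fps_hypergeo [- of_nat M] [] 1 *
            fps_hypergeo [\<alpha> + of_nat M, \<beta> + of_nat M] [\<gamma>] 1) J =
         (\<Sum>i\<le>M. of_nat (M choose i) * (pochhammer (\<alpha> + \<beta> + of_nat M - \<gamma>) i *
            (if i \<le> J then pochhammer (\<alpha> + of_nat i) (J - i) * pochhammer (\<beta> + of_nat i) (J - i) /
               fact (J - i) else 0))) / pochhammer \<gamma> J"
proof (induction M arbitrary: \<alpha> \<beta> J)
  case 0
  then show ?case
    by (simp add: fps_hypergeo_power_0)
next
  case (Suc M)
  note nz = pochhammer_nonzero[OF \<gamma>]
  \<comment> \<open>For \<open>i > J\<close> the value 0 stands for the reciprocal factorial of a
    negative integer; with it \<open>contig\<close> holds at every index.\<close>
  define W where "W \<alpha> \<beta> J i =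
    (if i \<le> J then pochhammer (\<alpha> + of_nat i) (J - i) * pochhammer (\<beta> + of_nat i) (J - i) /
               fact (J - i) else 0)" for \<alpha> \<beta> :: 'a and J i :: nat
  define L where "L = \<alpha> + \<beta> + of_nat (Suc M) - \<gamma>"
  define R where "R J = (\<Sum>i\<le>M. of_nat (M choose i) * (pochhammer (L + 1) i * W (\<alpha> + 1) (\<beta> + 1) J i))" for J
  define F where "F = fps_hypergeo [- of_nat M] [] 1 *
      fps_hypergeo [\<alpha> + of_nat (Suc M), \<beta> + of_nat (Suc M)] [\<gamma>] 1"
  have F: "fps_nth F J = R J / pochhammer \<gamma> J" for J
  proof -
    \<comment> \<open>The induction hypothesis is used at \<open>\<alpha> + 1\<close> and
      \<open>\<beta> + 1\<close>, which keeps the upper parameters and shifts \<open>L\<close> to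
      \<open>L + 1\<close>.\<close>
    have "\<alpha> + 1 + of_nat M = \<alpha> + of_nat (Suc M)" "\<beta> + 1 + of_nat M = \<beta> + of_nat (Suc M)"
      "\<alpha> + 1 + (\<beta> + 1) + of_nat M - \<gamma> = L + 1"
      by (simp_all add: L_def)
    then show ?thesis
      using Suc.IH[of "\<alpha> + 1" "\<beta> + 1" J]
      by (simp only: F_def R_def W_def)
  qed
  have "fps_hypergeo [- of_nat (Suc M)] [] 1 = fps_hypergeo [-1] [] 1 * fps_hypergeo [- of_nat M :: 'a] [] 1"
    unfolding fps_hypergeo_power_add by (simp add: algebra_simps)
  then have split: "fps_hypergeo [- of_nat (Suc M)] [] 1 *
      fps_hypergeo [\<alpha> + of_nat (Suc M), \<beta> + of_nat (Suc M)] [\<gamma>] 1 = (1 - fps_X) * F"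
    by (simp only: F_def fps_hypergeo_power_minus_1 mult.assoc)
  show ?case
  proof (cases J)
    case 0
    have "(\<Sum>i\<le>K. of_nat (K choose i) * (pochhammer z i * W x y 0 i)) = 1" for K z x y
      by (subst sum.mono_neutral_right[of _ "{0}"]) (auto simp: W_def)
    then show ?thesis
      unfolding split L_def[symmetric] W_def[symmetric] by (simp add: 0 F R_def ring_distribs del: sum.atMost_Suc of_nat_Suc)
  next
    case (Suc J')
    have contig: "W (\<alpha> + 1) (\<beta> + 1) J i - (\<gamma> + of_nat J') * W (\<alpha> + 1) (\<beta> + 1) J' i =
        W \<alpha> \<beta> J i + (L - of_nat M + of_nat i) * W \<alpha> \<beta> J (Suc i)" for i
    proof -
      consider "i \<le> J'" | "i = J" | "i > J" using Suc by linarith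
      then show ?thesis
      proof cases
        case 1
        then obtain j where j: "J' = i + j" using le_Suc_ex by blast
        define X where "X = pochhammer (\<alpha> + of_nat (Suc i)) j * pochhammer (\<beta> + of_nat (Suc i)) j /
          fact (Suc j)"
        have "pochhammer (x + 1 + of_nat i) (Suc j) = pochhammer (x + of_nat (Suc i)) j * (x + of_nat J)"
          for x :: 'a
          by (simp add: pochhammer_Suc Suc j add_ac)
        then have "W (\<alpha> + 1) (\<beta> + 1) J i = (\<alpha> + of_nat J) * (\<beta> + of_nat J) * X"
          by (simp add: W_def X_def Suc j del: of_nat_Suc fact_Suc)
        moreover have "W (\<alpha> + 1) (\<beta> + 1) J' i = of_nat (Suc j) * X"
        proof -
          have *: "x + 1 + of_nat i = x + of_nat (Suc i)" for x :: 'a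
            by simp
          show ?thesis
            by (simp add: W_def X_def j * del: of_nat_Suc)
        qed
        moreover have "W \<alpha> \<beta> J i = (\<alpha> + of_nat i) * (\<beta> + of_nat i) * X"
          by (simp add: W_def X_def Suc j pochhammer_rec add_ac)
        moreover have "W \<alpha> \<beta> J (Suc i) = of_nat (Suc j) * X"
          by (simp add: W_def X_def Suc j del: of_nat_Suc)
        moreover have "(\<alpha> + of_nat J) * (\<beta> + of_nat J) - (\<gamma> + of_nat J') * of_nat (Suc j) =
            (\<alpha> + of_nat i) * (\<beta> + of_nat i) + (L - of_nat M + of_nat i) * of_nat (Suc j)"
          by (simp add: Suc j L_def algebra_simps)
        ultimately show ?thesis
          by algebra
      qed (auto simp: W_def Suc)
    qed
    \<comment> \<open>\<open>g\<close> accounts for the exchange of \<open>pochhammer L i\<close>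
      and \<open>pochhammer (L + 1) i\<close>. It vanishes at 0, where both are 1, and at
      \<open>Suc M\<close>, where the binomial is 0.\<close>
    define g where "g i = of_nat (M choose i) * (pochhammer (L + 1) i - pochhammer L i) * W \<alpha> \<beta> J i" for i
    have g_Suc: "g (Suc i) = of_nat (M choose i) * (of_nat M - of_nat i) * pochhammer (L + 1) i * W \<alpha> \<beta> J (Suc i)"
      for i
    proof -
      have "pochhammer (L + 1) (Suc i) - pochhammer L (Suc i) = of_nat (Suc i) * pochhammer (L + 1) i"
        unfolding pochhammer_rec[of L] by (simp add: pochhammer_rec' algebra_simps)
      moreover have "of_nat (M choose Suc i) * of_nat (Suc i) = (of_nat (M choose i) * (of_nat M - of_nat i) :: 'a)"
        using of_nat_Suc_times_binomial_Suc[of i M, where ?'a = 'a] by (simp only: mult.commute)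
      ultimately show ?thesis
        unfolding g_def by (simp only: mult.assoc[symmetric])
    qed
    have "(\<Sum>i\<le>Suc M. of_nat (Suc M choose i) * (pochhammer L i * W \<alpha> \<beta> J i)) =
        (\<Sum>i\<le>M. of_nat (M choose i) * (pochhammer L i * W \<alpha> \<beta> J i +
             pochhammer L (Suc i) * W \<alpha> \<beta> J (Suc i)))"
      by (rule sum_binomial_Suc)
    also have "\<dots> = (\<Sum>i\<le>M. of_nat (M choose i) * (pochhammer (L + 1) i *
        (W (\<alpha> + 1) (\<beta> + 1) J i - (\<gamma> + of_nat J') * W (\<alpha> + 1) (\<beta> + 1) J' i)) + (g (Suc i) - g i))"
      unfolding contig
      by (intro sum.cong refl) (simp add: g_Suc, simp add: g_def pochhammer_rec algebra_simps)
    also have "\<dots> = R J - (\<gamma> + of_nat J') * R J' + (\<Sum>i\<le>M. g (Suc i) - g i)"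
      unfolding sum.distrib R_def sum_distrib_left
      by (simp add: algebra_simps sum_subtractf)
    also have "(\<Sum>i\<le>M. g (Suc i) - g i) = 0"
      unfolding lessThan_Suc_atMost[symmetric] sum_lessThan_telescope
      by (simp add: g_def binomial_eq_0)
    finally have "(\<Sum>i\<le>Suc M. of_nat (Suc M choose i) * (pochhammer L i * W \<alpha> \<beta> J i)) =
      R J - (\<gamma> + of_nat J') * R J'" by simp
    moreover have "fps_nth ((1 - fps_X) * F) J = (R J - (\<gamma> + of_nat J') * R J') / pochhammer \<gamma> J"
    proof -
      have "R J' / pochhammer \<gamma> J' = (\<gamma> + of_nat J') * R J' / pochhammer \<gamma> J"
        using nz[of J] by (simp add: Suc pochhammer_Suc)
      then show ?thesis
        by (simp add: left_diff_distrib F Suc diff_divide_distrib)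
    qed
    ultimately show ?thesis
      unfolding split L_def[symmetric] W_def[symmetric] by simp
  qed
qed

section \<open>Newton expansion of the Pochhammer quotient\<close>

text \<open>Polynomials in \<open>k\<close> of degree at most \<open>M\<close>, encoded in the
  Newton basis because each basis element turns a Gauss series into a shifted one.\<close>

definition newton_degree_le :: "nat \<Rightarrow> (nat \<Rightarrow> 'a::field_char_0) \<Rightarrow> bool" where
  "newton_degree_le M u \<longleftrightarrow> (\<exists>C. \<forall>k. u k = (\<Sum>s\<le>M. C s * of_nat (k choose s)))"

lemma newton_degree_le_const_mult:
  assumes "newton_degree_le M u"
  shows "newton_degree_le M (\<lambda>k. c * u k)"
proof -
  from assms obtain C where "\<And>k. u k = (\<Sum>s\<le>M. C s * of_nat (k choose s))"
    by (auto simp: newton_degree_le_def)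
  then show ?thesis
    by (auto simp: newton_degree_le_def sum_distrib_left mult.assoc intro!: exI[of _ "\<lambda>s. c * C s"])
qed

text \<open>The product \<open>(k choose s) * (x + k)\<close> equals
  \<open>(x + s) * (k choose s) + (s + 1) * (k choose (s + 1))\<close>.\<close>

lemma newton_degree_le_linear_mult:
  assumes "newton_degree_le M u"
  shows "newton_degree_le (Suc M) (\<lambda>k. u k * (x + of_nat k))"
proof -
  from assms obtain C where C: "\<And>k. u k = (\<Sum>s\<le>M. C s * of_nat (k choose s))"
    by (auto simp: newton_degree_le_def)
  \<comment> \<open>The first summand collects the terms that stay at \<open>s\<close> and is cut
    off beyond \<open>M\<close>, where \<open>C\<close> is arbitrary; the second collects those that
    move up from \<open>s - 1\<close>.\<close>
  define D where "D s = (if s \<le> M then C s * (x + of_nat s) else 0) +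
    (case s of 0 \<Rightarrow> 0 | Suc t \<Rightarrow> C t * of_nat s)" for s
  have "u k * (x + of_nat k) = (\<Sum>s\<le>Suc M. D s * of_nat (k choose s))" for k
  proof -
    have "C s * of_nat (k choose s) * (x + of_nat k) = C s * (x + of_nat s) * of_nat (k choose s) +
        C s * (of_nat (Suc s) * of_nat (k choose Suc s))" for s
      unfolding of_nat_Suc_times_binomial_Suc by (simp add: algebra_simps)
    then have "u k * (x + of_nat k) = (\<Sum>s\<le>M. C s * (x + of_nat s) * of_nat (k choose s)) +
        (\<Sum>s\<le>M. C s * (of_nat (Suc s) * of_nat (k choose Suc s)))"
      unfolding C sum_distrib_right by (simp only: sum.distrib)
    also have "(\<Sum>s\<le>M. C s * (x + of_nat s) * of_nat (k choose s)) =
        (\<Sum>s\<le>Suc M. (if s \<le> M then C s * (x + of_nat s) else 0) * of_nat (k choose s))"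
      by simp
    also have "(\<Sum>s\<le>M. C s * (of_nat (Suc s) * of_nat (k choose Suc s))) =
        (\<Sum>s\<le>Suc M. (case s of 0 \<Rightarrow> 0 | Suc t \<Rightarrow> C t * of_nat s) * of_nat (k choose s))"
      unfolding sum.atMost_Suc_shift by (simp add: mult.assoc)
    finally show ?thesis
      by (simp only: D_def distrib_right sum.distrib)
  qed
  then show ?thesis
    unfolding newton_degree_le_def by blast
qed

lemma newton_degree_le_pochhammer_mult:
  assumes "newton_degree_le M u"
  shows "newton_degree_le (j + M) (\<lambda>k. u k * pochhammer (x + of_nat k) j)"
proof (induction j)
  case (Suc j)
  show ?case
    using newton_degree_le_linear_mult[OF Suc.IH, of "x + of_nat j"]
    by (simp add: pochhammer_Suc mult.assoc add_ac)
qed (use assms in simp)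

text \<open>Both cross products are \<open>pochhammer x (j + k)\<close>. The right-hand side is
  visibly a polynomial of degree \<open>j\<close> in \<open>k\<close>.\<close>

lemma pochhammer_shift_quotient:
  fixes x :: "'a::field_char_0"
  assumes "x \<notin> \<int>\<^sub>\<le>\<^sub>0"
  shows "pochhammer (x + of_nat j) k / pochhammer x k = pochhammer (x + of_nat k) j / pochhammer x j"
  using pochhammer_product'[of x j k] pochhammer_product'[of x k j] pochhammer_nonzero[OF assms]
  by (simp add: field_simps)

text \<open>By \<open>pochhammer_shift_quotient\<close> each pair of parameters contributes a
  polynomial of degree \<open>j\<close>, and the degrees add up along the lists.\<close>

lemma newton_degree_le_pochhammer_quotient:
  fixes f :: "'a::field_char_0 list"
  assumes "length f = length ms" "set f \<inter> \<int>\<^sub>\<le>\<^sub>0 = {}"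
  shows "newton_degree_le (sum_list ms)
    (\<lambda>k. (\<Prod>a\<leftarrow>map2 (\<lambda>x j. x + of_nat j) f ms. pochhammer a k) / (\<Prod>b\<leftarrow>f. pochhammer b k))"
  using assms
proof (induction f ms rule: list_induct2)
  case Nil
  show ?case
    by (auto simp: newton_degree_le_def intro!: exI[of _ "\<lambda>_. 1"])
next
  case (Cons x f j ms)
  have "x \<notin> \<int>\<^sub>\<le>\<^sub>0" using Cons.prems by simp
  note * = pochhammer_shift_quotient[OF this, of j]
  have "(\<Prod>a\<leftarrow>map2 (\<lambda>x j. x + of_nat j) (x # f) (j # ms). pochhammer a k) / (\<Prod>b\<leftarrow>x # f. pochhammer b k) =
      1 / pochhammer x j * ((\<Prod>a\<leftarrow>map2 (\<lambda>x j. x + of_nat j) f ms. pochhammer a k) / (\<Prod>b\<leftarrow>f. pochhammer b k) *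
        pochhammer (x + of_nat k) j)" for k
  proof -
    have "(p * P) / (q * R) = (P / R * r)" if "p / q = r" for p q r P R :: 'a
      using that by auto
    from this[OF *[of k]] show ?thesis
      by simp
  qed
  moreover have "newton_degree_le (sum_list ms)
    (\<lambda>k. (\<Prod>a\<leftarrow>map2 (\<lambda>x j. x + of_nat j) f ms. pochhammer a k) / (\<Prod>b\<leftarrow>f. pochhammer b k))"
    using Cons by simp
  ultimately show ?case
    by (simp only: newton_degree_le_const_mult newton_degree_le_pochhammer_mult sum_list.Cons)
qed

text \<open>Choosing \<open>i\<close> of \<open>s\<close> and then \<open>r\<close> of these amounts
  to choosing the \<open>r\<close> first, which leaves the alternating sum over row
  \<open>s - r\<close>; it is 0 unless that row is row 0.\<close>

lemma binomial_orthogonality: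
  "(\<Sum>i\<le>s. (-1) ^ i * of_nat (s choose i) * of_nat (i choose r)) =
     (if r = s then (-1) ^ s else 0 :: 'a::comm_ring_1)"
proof (cases "r \<le> s")
  case True
  then obtain d where s: "s = r + d" using le_Suc_ex by blast
  have "(\<Sum>i\<le>s. (-1) ^ i * of_nat (s choose i) * of_nat (i choose r)) =
      (\<Sum>i\<in>{r..r+d}. (-1) ^ i * of_nat (s choose i) * of_nat (i choose r) :: 'a)"
    by (rule sum.mono_neutral_right) (auto simp: s binomial_eq_0)
  also have "\<dots> = (\<Sum>i\<le>d. (-1) ^ (r + i) * of_nat (s choose (r + i)) * of_nat ((r + i) choose r))"
    using sum.shift_bounds_cl_nat_ivl[of _ 0 r d] by (simp add: atMost_atLeast0 add.commute)
  also have "\<dots> = (-1) ^ r * of_nat (s choose r) * (\<Sum>i\<le>d. (-1) ^ i * of_nat (d choose i))"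
    unfolding sum_distrib_left
  proof (intro sum.cong refl)
    fix i assume "i \<in> {..d}"
    then have "(s choose (r + i)) * ((r + i) choose r) = (s choose r) * (d choose i)"
      using choose_mult[of r "r + i" s] by (simp add: s)
    then show "(-1) ^ (r + i) * of_nat (s choose (r + i)) * of_nat ((r + i) choose r) =
        (-1) ^ r * of_nat (s choose r) * ((-1) ^ i * of_nat (d choose i) :: 'a)"
      by (simp add: power_add mult.assoc mult.left_commute flip: of_nat_mult)
  qed
  finally show ?thesis
    using choose_alternating_sum[of d, where ?'a = 'a] by (cases "d = 0") (simp_all add: s)
qed (auto intro!: sum.neutral simp: binomial_eq_0)

text \<open>Binomial inversion: \<open>(-s)_i / i!\<close> is \<open>(-1)^i (s choose i)\<close>, so
  the inner sum recovers the Newton coefficient from the values of \<open>u\<close> by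
  orthogonality.\<close>

lemma newton_expansion:
  fixes u :: "nat \<Rightarrow> 'a::field_char_0"
  assumes "newton_degree_le M u"
  shows "u k = (\<Sum>s\<le>M. (-1) ^ s * (\<Sum>i\<le>s. pochhammer (- of_nat s) i * u i / fact i) * of_nat (k choose s))"
proof -
  from assms obtain C where C: "\<And>k. u k = (\<Sum>s\<le>M. C s * of_nat (k choose s))"
    by (auto simp: newton_degree_le_def)
  have *: "(-1) ^ s * (\<Sum>i\<le>s. pochhammer (- of_nat s) i * u i / fact i) = C s" if "s \<le> M" for s
  proof -
    have "pochhammer (- of_nat s) i * u i / fact i = (-1) ^ i * of_nat (s choose i) * u i" for i
      unfolding pochhammer_minus_of_nat_div_fact[symmetric] by simp
    then have "(\<Sum>i\<le>s. pochhammer (- of_nat s) i * u i / fact i) =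
        (\<Sum>r\<le>M. C r * (\<Sum>i\<le>s. (-1) ^ i * of_nat (s choose i) * of_nat (i choose r)))"
      unfolding C sum_distrib_left by (subst sum.swap) (simp add: mult_ac)
    also have "\<dots> = (\<Sum>r\<le>M. if r = s then C s * (-1) ^ s else 0)"
      unfolding binomial_orthogonality by (intro sum.cong) auto
    also have "\<dots> = C s * (-1) ^ s"
      using that by simp
    finally show ?thesis by simp
  qed
  show ?thesis
    unfolding C[of k] by (intro sum.cong refl) (simp only: * atMost_iff)
qed

text \<open>The Newton coefficients are, up to sign, the terminating series that enter
  \<open>Qhat\<close> as its first factor.\<close>

lemma pochhammer_quotient_newton:
  assumes "length f = length ms" "set f \<inter> \<int>\<^sub>\<le>\<^sub>0 = {}"
  shows "(\<Prod>a\<leftarrow>map2 (\<lambda>x j. x + of_nat j) f ms. pochhammer a k) / (\<Prod>b\<leftarrow>f. pochhammer b k) =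
    (\<Sum>s\<le>sum_list ms. (-1) ^ s * hypergeo1 (- of_nat s # map2 (\<lambda>x j. x + of_nat j) f ms) f *
       of_nat (k choose s))"
  unfolding hypergeo1_terminating
  using newton_expansion[OF newton_degree_le_pochhammer_quotient[OF assms], of k] by simp

section \<open>The second Miller-Paris transformation, coefficient by coefficient\<close>

text \<open>Factoring out the Pochhammer symbols of length \<open>J\<close> turns the sum of
  \<open>gauss_times_power_nth\<close> into the inner series of \<open>Qhat\<close>. The test
  \<open>i \<le> J\<close> becomes the vanishing of \<open>pochhammer (- of_nat J) i\<close>, and
  the assumptions keep the denominators nonzero for \<open>i \<le> M\<close>.\<close>

lemma gauss_times_power_hypergeo1:
  fixes \<alpha> \<beta> \<gamma> :: complex
  assumes \<gamma>: "\<gamma> \<notin> \<int>\<^sub>\<le>\<^sub>0" and \<alpha>: "pochhammer \<alpha> M \<noteq> 0" and \<beta>: "pochhammer \<beta> M \<noteq> 0"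
  shows "fps_nth (fps_hypergeo [- of_nat M] [] 1 *
            fps_hypergeo [\<alpha> + of_nat M, \<beta> + of_nat M] [\<gamma>] 1) J =
         pochhammer \<alpha> J * pochhammer \<beta> J / (pochhammer \<gamma> J * fact J) *
         hypergeo1 [- of_nat M, - of_nat J, \<alpha> + \<beta> + of_nat M - \<gamma>] [\<alpha>, \<beta>]"
proof -
  define L where "L = \<alpha> + \<beta> + of_nat M - \<gamma>"
  have "of_nat (M choose i) * (pochhammer L i *
      (if i \<le> J then pochhammer (\<alpha> + of_nat i) (J - i) * pochhammer (\<beta> + of_nat i) (J - i) / fact (J - i) else 0)) =
      pochhammer \<alpha> J * pochhammer \<beta> J / fact J *
       (pochhammer (- of_nat M) i * (pochhammer (- of_nat J) i * pochhammer L i) /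
         (pochhammer \<alpha> i * pochhammer \<beta> i * fact i))" (is "?L = ?R") if "i \<le> M" for i
  proof (cases "i \<le> J")
    case True
    have nz: "pochhammer \<alpha> i \<noteq> 0" "pochhammer \<beta> i \<noteq> 0"
      using \<alpha> \<beta> that pochhammer_neq_0_mono by blast+
    have J: "pochhammer (- of_nat J) i = ((-1) ^ i * fact J / fact (J - i) :: complex)"
      using pochhammer_minus_of_nat_div_fact[of J i, where ?'a = complex] True
      by (simp add: binomial_fact field_simps)
    have "?R = (pochhammer (- of_nat M) i / fact i) * ((-1) ^ i * pochhammer L i) *
        (pochhammer (\<alpha> + of_nat i) (J - i) * pochhammer (\<beta> + of_nat i) (J - i) / fact (J - i))"
      unfolding J pochhammer_product[OF True, of \<alpha>] pochhammer_product[OF True, of \<beta>]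
      using nz by (simp add: field_simps)
    also have "\<dots> = ?L"
      unfolding pochhammer_minus_of_nat_div_fact using True by (simp add: mult_ac)
    finally show ?thesis ..
  qed (simp add: pochhammer_of_nat_eq_0_iff)
  then have "(\<Sum>i\<le>M. of_nat (M choose i) * (pochhammer L i *
      (if i \<le> J then pochhammer (\<alpha> + of_nat i) (J - i) * pochhammer (\<beta> + of_nat i) (J - i) / fact (J - i) else 0))) =
      pochhammer \<alpha> J * pochhammer \<beta> J / fact J * hypergeo1 [- of_nat M, - of_nat J, L] [\<alpha>, \<beta>]"
    unfolding hypergeo1_terminating sum_distrib_left by (intro sum.cong) simp_all
  then show ?thesis
    unfolding gauss_times_power_nth[OF \<gamma>] L_def by (simp add: mult.commute)
qed

text \<open>\<open>(k choose s) / k!\<close> is \<open>1 / (s! (k - s)!)\<close>, and each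
  Pochhammer symbol of length \<open>k\<close> splits at \<open>s\<close>; for \<open>k < s\<close>
  both sides are 0.\<close>

lemma binomial_times_gauss:
  fixes a b c :: "'a::field_char_0"
  shows "Abs_fps (\<lambda>k. pochhammer a k * pochhammer b k / (pochhammer c k * fact k) * of_nat (k choose s)) =
    fps_const (pochhammer a s * pochhammer b s / (pochhammer c s * fact s)) *
      (fps_X ^ s * fps_hypergeo [a + of_nat s, b + of_nat s] [c + of_nat s] 1)"
proof (rule fps_ext)
  fix k
  show "fps_nth (Abs_fps (\<lambda>k. pochhammer a k * pochhammer b k / (pochhammer c k * fact k) * of_nat (k choose s))) k =
    fps_nth (fps_const (pochhammer a s * pochhammer b s / (pochhammer c s * fact s)) *
      (fps_X ^ s * fps_hypergeo [a + of_nat s, b + of_nat s] [c + of_nat s] 1)) k"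
  proof (cases "s \<le> k")
    case True
    then show ?thesis
      by (simp add: fps_X_power_mult_nth binomial_fact
        pochhammer_product[OF True, of a] pochhammer_product[OF True, of b] pochhammer_product[OF True, of c] mult_ac)
  qed (simp add: fps_X_power_mult_nth binomial_eq_0)
qed

text \<open>The contribution of one Newton basis element. The power of \<open>1 - X\<close> is split
  into the polynomial \<open>(1 - X)^(m - s)\<close> and the prefactor that Euler's transformation
  requires for the Gauss series shifted by \<open>s\<close>.\<close>

lemma gauss_times_power_Qhat_term:
  fixes a b c :: complex
  assumes c: "c \<notin> \<int>\<^sub>\<le>\<^sub>0" and s: "s \<le> m"
    and ca: "pochhammer (c - a - of_nat m) m \<noteq> 0" and cb: "pochhammer (c - b - of_nat m) m \<noteq> 0"
  shows "fps_nth (fps_hypergeo [c - a - b - of_nat m] [] 1 *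
      Abs_fps (\<lambda>k. pochhammer a k * pochhammer b k / (pochhammer c k * fact k) * of_nat (k choose s))) j =
    pochhammer (c - a - of_nat m) j * pochhammer (c - b - of_nat m) j / (pochhammer c j * fact j) *
    ((-1) ^ s * (pochhammer a s * pochhammer b s * pochhammer (- of_nat j) s /
        (pochhammer (c - a - of_nat m) s * pochhammer (c - b - of_nat m) s * fact s) *
        hypergeo1 [- of_nat m + of_nat s, - of_nat j + of_nat s, c - a - b - of_nat m]
          [c - a - of_nat m + of_nat s, c - b - of_nat m + of_nat s]))"
proof (cases "s \<le> j")
  case True
  define L \<alpha> \<beta> \<gamma> M J where "L = c - a - b - of_nat m" and "\<alpha> = c - a - of_nat m + of_nat s"
    and "\<beta> = c - b - of_nat m + of_nat s" and "\<gamma> = c + of_nat s" and "M = m - s" and "J = j - s"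
  note defs = L_def \<alpha>_def \<beta>_def \<gamma>_def
  have mM: "of_nat m = (of_nat M + of_nat s :: complex)" and jJ: "of_nat j = (of_nat J + of_nat s :: complex)"
    using s True by (simp_all add: M_def J_def of_nat_diff)
  have \<gamma>: "\<gamma> \<notin> \<int>\<^sub>\<le>\<^sub>0"
    unfolding \<gamma>_def by (rule plus_of_nat_notin_nonpos_Ints[OF c])
  have nz: "pochhammer \<alpha> M \<noteq> 0" "pochhammer \<beta> M \<noteq> 0" "pochhammer (c - a - of_nat m) s \<noteq> 0"
      "pochhammer (c - b - of_nat m) s \<noteq> 0" "pochhammer c s \<noteq> 0" "pochhammer \<gamma> J \<noteq> 0"
    using ca cb pochhammer_product[OF s, of "c - a - of_nat m"] pochhammer_product[OF s, of "c - b - of_nat m"]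
      pochhammer_nonzero[OF c] pochhammer_nonzero[OF \<gamma>]
    by (auto simp: \<alpha>_def \<beta>_def M_def)
  have "fps_hypergeo [L] [] 1 * fps_hypergeo [a + of_nat s, b + of_nat s] [\<gamma>] 1 =
      fps_hypergeo [- of_nat M] [] 1 *
      (fps_hypergeo [\<gamma> - (a + of_nat s) - (b + of_nat s)] [] 1 * fps_hypergeo [a + of_nat s, b + of_nat s] [\<gamma>] 1)"
  proof -
    have "- of_nat M + (\<gamma> - (a + of_nat s) - (b + of_nat s)) = L"
      by (simp add: defs mM)
    then show ?thesis
      by (simp only: mult.assoc[symmetric] fps_hypergeo_power_add)
  qed
  also have "\<dots> = fps_hypergeo [- of_nat M] [] 1 * fps_hypergeo [\<alpha> + of_nat M, \<beta> + of_nat M] [\<gamma>] 1"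
  proof -
    have *: "\<gamma> - (a + of_nat s) = \<alpha> + of_nat M" "\<gamma> - (b + of_nat s) = \<beta> + of_nat M"
      by (simp_all add: defs mM)
    show ?thesis
      unfolding euler_transformation[OF \<gamma>] unfolding * by (rule refl)
  qed
  finally have 1: "fps_nth (fps_hypergeo [L] [] 1 * fps_hypergeo [a + of_nat s, b + of_nat s] [\<gamma>] 1) J =
      pochhammer \<alpha> J * pochhammer \<beta> J / (pochhammer \<gamma> J * fact J) *
         hypergeo1 [- of_nat M, - of_nat J, L] [\<alpha>, \<beta>]"
    using gauss_times_power_hypergeo1[OF \<gamma> nz(1,2)] by (simp add: defs mM algebra_simps)
  have 2: "fps_nth (fps_hypergeo [L] [] 1 *
      Abs_fps (\<lambda>k. pochhammer a k * pochhammer b k / (pochhammer c k * fact k) * of_nat (k choose s))) j =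
    pochhammer a s * pochhammer b s / (pochhammer c s * fact s) *
     fps_nth (fps_hypergeo [L] [] 1 * fps_hypergeo [a + of_nat s, b + of_nat s] [\<gamma>] 1) J"
  proof -
    have *: "fps_hypergeo [L] [] 1 * (fps_const x * (fps_X ^ s * F)) =
        fps_const x * (fps_X ^ s * (fps_hypergeo [L] [] 1 * F))" for x and F :: "complex fps"
      by (simp only: mult_ac)
    show ?thesis
      unfolding binomial_times_gauss \<gamma>_def[symmetric] * using True
      by (simp add: fps_X_power_mult_nth J_def)
  qed
  \<comment> \<open>Passing from \<open>fact J\<close> to \<open>fact j\<close> is the source of
    this symbol in \<open>Qhat\<close>.\<close>
  have 3: "pochhammer (- of_nat j) s = ((-1) ^ s * fact j / fact J :: complex)"
    using pochhammer_minus_of_nat_div_fact[of j s, where ?'a = complex] True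
    by (simp add: binomial_fact J_def field_simps)
  have 4: "- of_nat m + of_nat s = (- of_nat M :: complex)" "- of_nat j + of_nat s = (- of_nat J :: complex)"
    by (simp_all add: mM jJ)
  have 5: "pochhammer (c - a - of_nat m) j = pochhammer (c - a - of_nat m) s * pochhammer \<alpha> J"
    "pochhammer (c - b - of_nat m) j = pochhammer (c - b - of_nat m) s * pochhammer \<beta> J"
    "pochhammer c j = pochhammer c s * pochhammer \<gamma> J"
    using pochhammer_product[OF True] by (simp_all add: defs J_def)
  show ?thesis
    unfolding L_def[symmetric] \<alpha>_def[symmetric] \<beta>_def[symmetric]
    unfolding 2 1 3 4 5
    using nz by (simp add: divide_simps)
next
  case False
  \<comment> \<open>For \<open>s > j\<close> the factor \<open>X^s\<close> kills the coefficient,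
    and \<open>pochhammer (- of_nat j) s\<close> is 0.\<close>
  then show ?thesis
    unfolding binomial_times_gauss
    by (simp add: mult.left_commute[of "fps_hypergeo _ _ _"] fps_X_power_mult_nth pochhammer_of_nat_eq_0_iff)
qed

lemma foldl_mult_pochhammer:
  fixes x :: "'a::comm_ring_1"
  shows "foldl (\<lambda>r a. r * pochhammer a k) x as = x * (\<Prod>a\<leftarrow>as. pochhammer a k)"
  by (induction as arbitrary: x) (simp_all add: mult.assoc)

text \<open>Linearity: the quotient of the symbols with parameters \<open>f\<close> is expanded in
  the Newton basis, and the contributions of the basis elements add up to \<open>Qhat\<close> at
  \<open>- of_nat j\<close>.\<close>

lemma miller_paris_nth:
  fixes a b c :: complex
  assumes f: "length f = length ms" "set f \<inter> \<int>\<^sub>\<le>\<^sub>0 = {}" and m: "m = sum_list ms"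
    and c: "c \<notin> \<int>\<^sub>\<le>\<^sub>0"
    and ca: "pochhammer (c - a - of_nat m) m \<noteq> 0" and cb: "pochhammer (c - b - of_nat m) m \<noteq> 0"
  shows "fps_nth (fps_hypergeo [c - a - b - of_nat m] [] 1 *
      fps_hypergeo ([a, b] @ map2 (\<lambda>x j. x + of_nat j) f ms) (c # f) 1) j =
    pochhammer (c - a - of_nat m) j * pochhammer (c - b - of_nat m) j / (pochhammer c j * fact j) *
      Qhat m a b c f ms (- of_nat j)"
proof -
  define P where "P = fps_hypergeo [c - a - b - of_nat m] [] 1"
  define F where "F s = (-1) ^ s * hypergeo1 (- of_nat s # map2 (\<lambda>x j. x + of_nat j) f ms) f" for s
  define A where "A s = Abs_fps (\<lambda>k. pochhammer a k * pochhammer b k / (pochhammer c k * fact k) * of_nat (k choose s))" for s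
  have "fps_hypergeo ([a, b] @ map2 (\<lambda>x j. x + of_nat j) f ms) (c # f) 1 = (\<Sum>s\<le>m. fps_const (F s) * A s)"
  proof (rule fps_ext)
    fix k
    have "fps_nth (fps_hypergeo ([a, b] @ map2 (\<lambda>x j. x + of_nat j) f ms) (c # f) 1) k =
        pochhammer a k * pochhammer b k / (pochhammer c k * fact k) *
        ((\<Prod>a\<leftarrow>map2 (\<lambda>x j. x + of_nat j) f ms. pochhammer a k) / (\<Prod>b\<leftarrow>f. pochhammer b k))"
      by (simp add: foldl_mult_pochhammer mult_ac)
    also have "\<dots> = fps_nth (\<Sum>s\<le>m. fps_const (F s) * A s) k"
      unfolding pochhammer_quotient_newton[OF f] fps_sum_nth fps_mult_left_const_nth sum_distrib_left
      by (simp add: m F_def A_def mult_ac)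
    finally show "fps_nth (fps_hypergeo ([a, b] @ map2 (\<lambda>x j. x + of_nat j) f ms) (c # f) 1) k =
      fps_nth (\<Sum>s\<le>m. fps_const (F s) * A s) k" .
  qed
  then have "fps_nth (P * fps_hypergeo ([a, b] @ map2 (\<lambda>x j. x + of_nat j) f ms) (c # f) 1) j =
      (\<Sum>s\<le>m. F s * fps_nth (P * A s) j)"
    by (simp add: sum_distrib_left fps_sum_nth mult.left_commute[of P])
  also have "\<dots> = pochhammer (c - a - of_nat m) j * pochhammer (c - b - of_nat m) j / (pochhammer c j * fact j) *
      Qhat m a b c f ms (- of_nat j)"
    unfolding Qhat_def sum_distrib_left
  proof (intro sum.cong refl)
    fix s assume "s \<in> {..m}"
    then have s: "s \<le> m" by simp
    \<comment> \<open>The sign of the Newton coefficient cancels the one that comes with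
      \<open>pochhammer (- of_nat j) s\<close>.\<close>
    have "F s * (x * ((-1) ^ s * (y / z * w))) =
      x * (hypergeo1 (- of_nat s # map2 (\<lambda>x j. x + of_nat j) f ms) f * y / z * w)" for x y z w
      by (simp add: F_def)
    then show "F s * fps_nth (P * A s) j =
      pochhammer (c - a - of_nat m) j * pochhammer (c - b - of_nat m) j / (pochhammer c j * fact j) *
      (hypergeo1 (- of_nat s # map2 (\<lambda>x j. x + of_nat j) f ms) f *
        pochhammer a s * pochhammer b s * pochhammer (- of_nat j) s /
          (pochhammer (c - a - of_nat m) s * pochhammer (c - b - of_nat m) s * fact s) *
        hypergeo1 [- of_nat m + of_nat s, - of_nat j + of_nat s, c - a - b - of_nat m]
          [c - a - of_nat m + of_nat s, c - b - of_nat m + of_nat s])"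
      unfolding P_def A_def gauss_times_power_Qhat_term[OF c s ca cb] by (simp only: mult.assoc)
  qed
  finally show ?thesis
    by (simp only: P_def)
qed

section \<open>Saalschuetzian sums with a linear factor\<close>

text \<open>
  Writing \<open>i t\<^sub>i\<close> and \<open>(i - N) t\<^sub>i\<close> (with \<open>t\<^sub>i\<close> the summand for the factor 1) as shifted
  hypergeometric terms makes both sums Saalschuetzian of length \<open>N - 1\<close>; \<open>H + i\<close> is a combination
  of the two factors.
\<close>
lemma saalschuetz_linear_factor:
  fixes D E G H L :: complex
  assumes G: "G \<notin> \<int>\<^sub>\<le>\<^sub>0" and E: "E \<notin> \<int>\<^sub>\<le>\<^sub>0" and bal: "G + E + of_nat N - D + L = 2"
    and N0: "N = 0 \<Longrightarrow> G + L \<noteq> 1 \<and> E + L \<noteq> 1"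
  shows "(\<Sum>i\<le>N. pochhammer (- of_nat N) i * pochhammer D i * pochhammer (- L) i /
            (pochhammer G i * pochhammer E i * fact i) * (H + of_nat i)) =
         rising (G + L) (int N - 1) * rising (E + L) (int N - 1) / (pochhammer G N * pochhammer E N) *
         (of_nat N * D * (H + L) + H * (G + L - 1) * (E + L - 1))"
proof (cases N)
  case 0
  \<comment> \<open>For \<open>N = 0\<close> the \<open>rising\<close> factors are
    \<open>1 / (G + L - 1)\<close> and \<open>1 / (E + L - 1)\<close>, which cancel against the
    bracket.\<close>
  with N0 have "G + L - 1 \<noteq> 0" "E + L - 1 \<noteq> 0" by auto
  then show ?thesis
    by (simp add: 0 rising_def)
next
  case (Suc K)
  define t where "t i = pochhammer (- of_nat N) i * pochhammer D i * pochhammer (- L) i /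
            (pochhammer G i * pochhammer E i * fact i)" for i
  define S where "S = (\<Sum>i\<le>N. t i)"
  define T where "T = (\<Sum>i\<le>N. of_nat i * t i)"
  define P where "P = pochhammer (G + L) K * pochhammer (E + L) K / (pochhammer G N * pochhammer E N)"
  have nz: "pochhammer G K \<noteq> 0" "pochhammer E K \<noteq> 0" "G + of_nat K \<noteq> 0" "E + of_nat K \<noteq> 0" "G \<noteq> 0" "E \<noteq> 0"
    using G E pochhammer_nonzero plus_of_nat_eq_0_imp by blast+
  have G1: "G + 1 \<notin> \<int>\<^sub>\<le>\<^sub>0" and E1: "E + 1 \<notin> \<int>\<^sub>\<le>\<^sub>0"
    using plus_of_nat_notin_nonpos_Ints[OF G, of 1] plus_of_nat_notin_nonpos_Ints[OF E, of 1] by simp_all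
  have NK: "- of_nat N + 1 = (- of_nat K :: complex)"
    by (simp add: Suc)
  \<comment> \<open>The summand at 0 vanishes, and shifting the index by one raises every parameter
    by 1.\<close>
  have "T = (\<Sum>i\<le>K. of_nat (Suc i) * t (Suc i))"
    unfolding T_def Suc sum.atMost_Suc_shift by simp
  also have "\<dots> = (\<Sum>i\<le>K. of_nat N * D * L / (G * E) *
      (pochhammer (- of_nat K) i * pochhammer (D + 1) i * pochhammer (1 - L) i /
            (pochhammer (G + 1) i * pochhammer (E + 1) i * fact i)))"
  proof (intro sum.cong refl)
    fix i
    have "of_nat (Suc i) * t (Suc i) = of_nat (Suc i) *
      ((- of_nat N * pochhammer (- of_nat K) i) * (D * pochhammer (D + 1) i) * (- L * pochhammer (1 - L) i) /
        ((G * pochhammer (G + 1) i) * (E * pochhammer (E + 1) i) * (of_nat (Suc i) * fact i)))"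
      unfolding t_def pochhammer_rec NK fact_Suc by simp
    also have "\<dots> = of_nat N * D * L / (G * E) *
      (pochhammer (- of_nat K) i * pochhammer (D + 1) i * pochhammer (1 - L) i /
            (pochhammer (G + 1) i * pochhammer (E + 1) i * fact i))"
      using of_nat_neq_0[of i, where ?'a = complex] by (simp add: mult_ac del: of_nat_Suc)
    finally show "of_nat (Suc i) * t (Suc i) = of_nat N * D * L / (G * E) *
      (pochhammer (- of_nat K) i * pochhammer (D + 1) i * pochhammer (1 - L) i /
            (pochhammer (G + 1) i * pochhammer (E + 1) i * fact i))" .
  qed
  also have "\<dots> = of_nat N * D * L / (G * E) *
      (pochhammer (G + L) K * pochhammer (E + L) K / (pochhammer (G + 1) K * pochhammer (E + 1) K))"
  proof -
    have "G + 1 + (E + 1) = 1 + (D + 1) + (1 - L) - of_nat K"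
      using bal by (simp add: Suc algebra_simps)
    from saalschuetz[OF G1 E1 this] show ?thesis
      unfolding sum_distrib_left[symmetric] by simp
  qed
  also have "\<dots> = of_nat N * D * L * P"
    by (simp add: P_def Suc pochhammer_rec)
  finally have T: "T = of_nat N * D * L * P" .
  \<comment> \<open>Absorbing \<open>i - N\<close> replaces the parameter \<open>-N\<close> by
    \<open>-K\<close>, so the summand at \<open>N\<close> vanishes and the remaining sum is
    balanced.\<close>
  have shift: "(of_nat i - of_nat N) * pochhammer (- of_nat N) i = - of_nat N * (pochhammer (- of_nat K) i :: complex)" for i
    using pochhammer_rec[of "- of_nat N :: complex" i] pochhammer_rec'[of "- of_nat N :: complex" i] NK by simp
  have "T - of_nat N * S = (\<Sum>i\<le>N. (of_nat i - of_nat N) * t i)"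
    by (simp add: T_def S_def sum_distrib_left left_diff_distrib sum_subtractf)
  also have "\<dots> = (\<Sum>i\<le>N. - of_nat N * (pochhammer (- of_nat K) i * pochhammer D i * pochhammer (- L) i /
            (pochhammer G i * pochhammer E i * fact i)))"
  proof (intro sum.cong refl)
    fix i
    have "(of_nat i - of_nat N) * t i = ((of_nat i - of_nat N) * pochhammer (- of_nat N) i) *
        (pochhammer D i * pochhammer (- L) i / (pochhammer G i * pochhammer E i * fact i))"
      by (simp add: t_def)
    then show "(of_nat i - of_nat N) * t i = - of_nat N * (pochhammer (- of_nat K) i * pochhammer D i * pochhammer (- L) i /
            (pochhammer G i * pochhammer E i * fact i))"
      unfolding shift by simp
  qed
  also have "\<dots> = - of_nat N * (\<Sum>i\<le>K. pochhammer (- of_nat K) i * pochhammer D i * pochhammer (- L) i /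
            (pochhammer G i * pochhammer E i * fact i))"
    unfolding sum_distrib_left[symmetric] by (simp add: Suc pochhammer_of_nat_eq_0_lemma)
  also have "\<dots> = - of_nat N * (pochhammer (G + L) K * pochhammer (E + L) K / (pochhammer G K * pochhammer E K))"
    using saalschuetz[OF G E, of D "- L" K] bal by (simp add: Suc algebra_simps)
  also have "\<dots> = - of_nat N * (P * (G + of_nat K) * (E + of_nat K))"
    using nz by (simp add: P_def Suc pochhammer_Suc)
  finally have "T - of_nat N * S = - of_nat N * (P * (G + of_nat K) * (E + of_nat K))" .
  then have "of_nat N * S = of_nat N * (P * (D * L + (G + of_nat K) * (E + of_nat K)))"
    unfolding T by (simp add: algebra_simps)
  then have S: "S = P * (D * L + (G + of_nat K) * (E + of_nat K))"
    using Suc by (simp del: of_nat_Suc)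
  have D: "D = G + E + of_nat K + L - 1"
    using bal by (simp add: Suc algebra_simps)
  have *: "D * L + (G + of_nat K) * (E + of_nat K) = of_nat N * D + (G + L - 1) * (E + L - 1)"
    unfolding D Suc by (simp add: algebra_simps)
  have "H * S + T = P * (of_nat N * D * (H + L) + H * (G + L - 1) * (E + L - 1))"
    unfolding S T * by (simp add: algebra_simps)
  moreover have "(\<Sum>i\<le>N. t i * (H + of_nat i)) = H * S + T"
    by (simp add: S_def T_def sum_distrib_left sum.distrib algebra_simps)
  ultimately show ?thesis
    by (simp add: t_def P_def Suc rising_def)
qed

lemma pochhammer_plus_1_quotient:
  fixes x :: "'a::field_char_0"
  assumes "x \<notin> \<int>\<^sub>\<le>\<^sub>0"
  shows "pochhammer (x + 1) k / pochhammer x k = (x + of_nat k) / x"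
  using pochhammer_shift_quotient[OF assms, of 1 k] by simp

text \<open>A Pochhammer symbol of length \<open>n - 1\<close> splits at \<open>j\<close>. For
  \<open>j = n > 0\<close> the second factor is \<open>1 / (x + n - 1)\<close>, which removes the
  last factor of \<open>pochhammer x n\<close>.\<close>

lemma pochhammer_mult_rising:
  assumes "x \<notin> \<int>\<^sub>\<le>\<^sub>0" and "j \<le> n"
  shows "pochhammer x j * rising (x + of_nat j) (int (n - j) - 1) = rising x (int n - 1)"
proof (cases "j = n")
  case False
  with assms(2) obtain d where n: "n = Suc (j + d)"
    using less_imp_Suc_add[of j n] by auto
  then have *: "int (n - j) - 1 = int d" "int n - 1 = int (j + d)"
    by simp_all
  show ?thesis
    unfolding * by (simp add: rising_def pochhammer_product' del: of_nat_add)
next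
  case True
  show ?thesis
  proof (cases n)
    case (Suc k)
    have "x + of_nat k \<noteq> 0"
      using assms(1) plus_of_nat_eq_0_imp by blast
    then show ?thesis
      by (simp add: True Suc rising_def pochhammer_Suc)
  qed (simp add: True)
qed

section \<open>Summing the coefficient identity\<close>

text \<open>Reindexing the triangle \<open>j + i \<le> n\<close> isolates, for each
  \<open>j\<close>, an inner sum over the second factor of the Cauchy product alone.\<close>

lemma sum_fps_mult_nth:
  fixes B C :: "'a::comm_ring_1 fps"
  shows "(\<Sum>k\<le>n. fps_nth (B * C) k * w k) =
    (\<Sum>j\<le>n. fps_nth B j * (\<Sum>i\<le>n - j. fps_nth C i * w (j + i)))"
proof -
  have "(\<Sum>k\<le>n. fps_nth (B * C) k * w k) =
      (\<Sum>k\<le>n. \<Sum>j\<le>k. fps_nth B j * (fps_nth C (k - j) * w (j + (k - j))))"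
    by (simp add: fps_mult_nth sum_distrib_right atMost_atLeast0 mult.assoc)
  also have "\<dots> = (\<Sum>(j, i)\<in>{(j, i). j + i \<le> n}. fps_nth B j * (fps_nth C i * w (j + i)))"
    by (rule sum.triangle_reindex_eq[symmetric])
  also have "{(j, i). j + i \<le> n} = Sigma {..n} (\<lambda>j. {..n - j})"
    by auto
  also have "(\<Sum>(j, i)\<in>Sigma {..n} (\<lambda>j. {..n - j}). fps_nth B j * (fps_nth C i * w (j + i))) =
      (\<Sum>j\<le>n. fps_nth B j * (\<Sum>i\<le>n - j. fps_nth C i * w (j + i)))"
    by (subst sum.Sigma[symmetric]) (simp_all add: sum_distrib_left)
  finally show ?thesis .
qed

text \<open>Each zero contributes \<open>(-j - z) (z)_j = -z (z + 1)_j\<close>, both sides being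
  \<open>-(z)_(j + 1)\<close>; the leading coefficient is common.\<close>

lemma poly_proots_shift:
  fixes Q :: "complex poly"
  assumes zeros: "mset zs = proots Q"
  shows "poly Q (- of_nat j) * (\<Prod>z\<leftarrow>zs. pochhammer z j) = poly Q 0 * (\<Prod>z\<leftarrow>map (\<lambda>z. z + 1) zs. pochhammer z j)"
proof -
  have Q: "poly Q t = lead_coeff Q * (\<Prod>z\<leftarrow>zs. t - z)" for t
  proof -
    have "Q = smult (lead_coeff Q) (\<Prod>z\<leftarrow>zs. [:- z, 1:])"
      unfolding prod_mset_prod_list[symmetric] mset_map zeros
      by (rule complex_poly_decompose_multiset[symmetric])
    then have "poly Q t = lead_coeff Q * poly (\<Prod>z\<leftarrow>zs. [:- z, 1:]) t"
      by (metis poly_smult)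
    also have "poly (\<Prod>z\<leftarrow>zs. [:- z, 1:]) t = (\<Prod>z\<leftarrow>zs. t - z)"
      by (induction zs) (simp_all add: algebra_simps)
    finally show ?thesis .
  qed
  have "(\<Prod>z\<leftarrow>zs. - of_nat j - z) * (\<Prod>z\<leftarrow>zs. pochhammer z j) =
      (\<Prod>z\<leftarrow>zs. 0 - z) * (\<Prod>z\<leftarrow>map (\<lambda>z. z + 1) zs. pochhammer z j)"
  proof (induction zs)
    case (Cons z zs)
    have 1: "(- of_nat j - z) * pochhammer z j = (0 - z) * pochhammer (z + 1) j"
      using pochhammer_rec[of z j] pochhammer_rec'[of z j] by (simp add: algebra_simps)
    have 2: "(\<Prod>z\<leftarrow>zs. - of_nat j - z) * (\<Prod>z\<leftarrow>zs. pochhammer z j) =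
      (\<Prod>z\<leftarrow>zs. 0 - z) * (\<Prod>z\<leftarrow>map (\<lambda>z. z + 1) zs. pochhammer z j)"
      by (rule Cons)
    have "(x * X) * (y * Y) = (u * U) * (v * V)" if "x * y = u * v" "X * Y = U * V"
      for x y u v X Y U V :: complex
      using arg_cong2[OF that, of "(*)"] by (simp only: mult_ac)
    from this[OF 1 2] show ?case
      by (simp only: list.map prod_list.Cons)
  qed simp
  then show ?thesis
    unfolding Q by (simp only: mult.assoc)
qed

lemma sum_list_shift:
  "length f = length ms \<Longrightarrow>
    sum_list (map2 (\<lambda>x j. x + of_nat j) f ms) = sum_list f + (of_nat (sum_list ms) :: 'a::comm_ring_1)"
  by (induction f ms rule: list_induct2) simp_all

text \<open>Splitting every Pochhammer symbol at \<open>j\<close> leads to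
  \<open>saalschuetz_linear_factor\<close> with \<open>N = n - j\<close> and shifted parameters,
  while \<open>(h + 1)_k / (h)_k = (h + k) / h\<close> supplies the linear factor. The resulting
  bracket is affine in \<open>j\<close>, with the numerator and the denominator of
  \<open>\<mu>\<close> as coefficients.\<close>

lemma saalschuetz_linear_factor_tail:
  fixes g e d h lam :: complex
  assumes g: "g \<notin> \<int>\<^sub>\<le>\<^sub>0" and e: "e \<notin> \<int>\<^sub>\<le>\<^sub>0" and h: "h \<notin> \<int>\<^sub>\<le>\<^sub>0"
    and gl: "g + lam \<notin> \<int>\<^sub>\<le>\<^sub>0" and el: "e + lam \<notin> \<int>\<^sub>\<le>\<^sub>0"
    and bal: "g + e + of_nat n - d + lam = 2"
    and n0: "n \<noteq> 0 \<or> g + lam \<noteq> 1 \<and> e + lam \<noteq> 1"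
    and j: "j \<le> n"
  shows "(\<Sum>i\<le>n - j. pochhammer (- lam) i / fact i *
      (pochhammer (- of_nat n) (j + i) * pochhammer d (j + i) * pochhammer (h + 1) (j + i) /
        (pochhammer g (j + i) * pochhammer e (j + i) * pochhammer h (j + i)))) =
    rising (g + lam) (int n - 1) * rising (e + lam) (int n - 1) / (h * pochhammer g n * pochhammer e n) *
    (pochhammer (- of_nat n) j * pochhammer d j / (pochhammer (g + lam) j * pochhammer (e + lam) j)) *
    ((of_nat n * d * (h + lam) + h * (g + lam - 1) * (e + lam - 1)) +
      of_nat j * (lam * (h - g + 1) - (g + of_nat n - 1) * (g - d - 1)))"
proof -
  define N where "N = n - j"
  have nN: "of_nat n = (of_nat j + of_nat N :: complex)"
    using j by (simp add: N_def of_nat_diff)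
  define D G E H where "D = d + of_nat j" and "G = g + of_nat j" and "E = e + of_nat j" and "H = h + of_nat j"
  have G: "G \<notin> \<int>\<^sub>\<le>\<^sub>0" and E: "E \<notin> \<int>\<^sub>\<le>\<^sub>0"
    unfolding G_def E_def using g e by (simp_all add: plus_of_nat_notin_nonpos_Ints)
  have bal': "G + E + of_nat N - D + lam = 2"
    using bal by (simp add: D_def G_def E_def nN algebra_simps)
  \<comment> \<open>If \<open>j = n > 0\<close>, then \<open>G + lam = 1\<close> would make
    \<open>g + lam\<close> the non-positive integer \<open>1 - n\<close>; likewise for
    \<open>e\<close>.\<close>
  have N0: "G + lam \<noteq> 1 \<and> E + lam \<noteq> 1" if "N = 0"
  proof (cases n)
    case 0
    then show ?thesis using n0 j by (simp add: G_def E_def)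
  next
    case (Suc k)
    with that j have "j = Suc k" by (simp add: N_def)
    then show ?thesis
      using plus_of_nat_eq_0_imp[of "g + lam" k] plus_of_nat_eq_0_imp[of "e + lam" k] gl el
      by (auto simp: G_def E_def add_ac)
  qed
  define x where "x = pochhammer (- of_nat n) j * pochhammer d j / (pochhammer g j * pochhammer e j * h)"
  have "pochhammer (- lam) i / fact i *
      (pochhammer (- of_nat n) (j + i) * pochhammer d (j + i) * pochhammer (h + 1) (j + i) /
        (pochhammer g (j + i) * pochhammer e (j + i) * pochhammer h (j + i))) =
      x * (pochhammer (- of_nat N) i * pochhammer D i * pochhammer (- lam) i /
            (pochhammer G i * pochhammer E i * fact i) * (H + of_nat i))" for i
  proof -
    have n: "- of_nat n + of_nat j = (- of_nat N :: complex)"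
      by (simp add: nN)
    have h': "pochhammer (h + 1) (j + i) / pochhammer h (j + i) = (H + of_nat i) / h"
      using pochhammer_plus_1_quotient[OF h, of "j + i"] by (simp add: H_def add_ac)
    have "pochhammer (- lam) i / fact i *
      (pochhammer (- of_nat n) (j + i) * pochhammer d (j + i) * pochhammer (h + 1) (j + i) /
        (pochhammer g (j + i) * pochhammer e (j + i) * pochhammer h (j + i))) =
      pochhammer (- lam) i / fact i *
      (pochhammer (- of_nat n) (j + i) * pochhammer d (j + i) / (pochhammer g (j + i) * pochhammer e (j + i))) *
      (pochhammer (h + 1) (j + i) / pochhammer h (j + i))"
      by (simp add: mult_ac)
    also have "\<dots> = x * (pochhammer (- of_nat N) i * pochhammer D i * pochhammer (- lam) i /
            (pochhammer G i * pochhammer E i * fact i) * (H + of_nat i))"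
      unfolding h' unfolding pochhammer_product' n x_def D_def[symmetric] G_def[symmetric] E_def[symmetric]
      by (simp add: mult_ac)
    finally show ?thesis .
  qed
  then have "(\<Sum>i\<le>n - j. pochhammer (- lam) i / fact i *
      (pochhammer (- of_nat n) (j + i) * pochhammer d (j + i) * pochhammer (h + 1) (j + i) /
        (pochhammer g (j + i) * pochhammer e (j + i) * pochhammer h (j + i)))) =
      x * (rising (G + lam) (int N - 1) * rising (E + lam) (int N - 1) / (pochhammer G N * pochhammer E N) *
         (of_nat N * D * (H + lam) + H * (G + lam - 1) * (E + lam - 1)))"
    by (simp only: sum_distrib_left[symmetric] N_def[symmetric] saalschuetz_linear_factor[OF G E bal' N0])
  \<comment> \<open>The cubic terms in \<open>j\<close> cancel outright, the quadratic ones by the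
    balance condition.\<close>
  also have "of_nat N * D * (H + lam) + H * (G + lam - 1) * (E + lam - 1) =
      (of_nat n * d * (h + lam) + h * (g + lam - 1) * (e + lam - 1)) +
      of_nat j * (lam * (h - g + 1) - (g + of_nat n - 1) * (g - d - 1))"
  proof -
    have d: "d = g + e + of_nat j + of_nat N + lam - 2"
      using bal by (simp add: nN algebra_simps)
    show ?thesis
      unfolding D_def G_def E_def H_def nN d by (simp add: algebra_simps)
  qed
  also have "rising (G + lam) (int N - 1) = rising (g + lam) (int n - 1) / pochhammer (g + lam) j"
    using pochhammer_mult_rising[OF gl j] pochhammer_nonzero[OF gl, of j]
    by (simp add: G_def N_def[symmetric] field_simps)
  also have "rising (E + lam) (int N - 1) = rising (e + lam) (int n - 1) / pochhammer (e + lam) j"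
    using pochhammer_mult_rising[OF el j] pochhammer_nonzero[OF el, of j]
    by (simp add: E_def N_def[symmetric] field_simps)
  finally show ?thesis
    unfolding x_def pochhammer_product[OF j, of g] pochhammer_product[OF j, of e]
    by (simp add: G_def E_def N_def mult_ac)
qed

section \<open>The transformation of the terminating series\<close>

theorem theorem3:
  fixes r m n :: nat and ms :: "nat list" and f zs :: "complex list"
    and a b c d e g h lam \<Omega> \<mu> :: complex and Q :: "complex poly"
  assumes "length ms = r" and "length f = r" and "m = sum_list ms"
    and lam: "lam = c - a - b - of_nat m"
    and "pochhammer (1 + a + b - c) m \<noteq> 0"
    and "pochhammer (c - a - of_nat m) m \<noteq> 0"
    and "pochhammer (c - b - of_nat m) m \<noteq> 0"
    and "g + e + of_nat n - d + lam = 2"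
    and Omega: "\<Omega> =
      rising (g + lam) (int n - 1) * rising (e + lam) (int n - 1) /
        (h * pochhammer g n * pochhammer e n) *
      (of_nat n * d * (h + lam) + h * (g + lam - 1) * (e + lam - 1))"
    and mu: "\<mu> =
      (of_nat n * d * (h + lam) + h * (g + lam - 1) * (e + lam - 1)) /
      (lam * (h - g + 1) - (g + of_nat n - 1) * (g - d - 1))"
    and Q: "\<And>t. poly Q t = Qhat m a b c f ms t" and "degree Q = m"
    and zeros: "mset zs = proots Q"
    and lower_left: "set ([c, g, e, h] @ f) \<inter> \<int>\<^sub>\<le>\<^sub>0 = {}"
    and lower_right: "set ([g + lam, e + lam, c, \<mu>] @ zs) \<inter> \<int>\<^sub>\<le>\<^sub>0 = {}"
    and denom_mu: "lam * (h - g + 1) - (g + of_nat n - 1) * (g - d - 1) \<noteq> 0"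
    and denom_Omega: "n = 0 \<Longrightarrow> g + lam \<noteq> 1 \<and> e + lam \<noteq> 1"
  shows "hypergeo1
           ([- of_nat n, a, b, d, h + 1] @ map2 (\<lambda>x j. x + of_nat j) f ms)
           ([c, g, e, h] @ f)
         = \<Omega> * hypergeo1
           ([- of_nat n, d, a + lam, b + lam, \<mu> + 1] @ map (\<lambda>z. z + 1) zs)
           ([g + lam, e + lam, c, \<mu>] @ zs)
       \<and> saalschutzian
           ([- of_nat n, a, b, d, h + 1] @ map2 (\<lambda>x j. x + of_nat j) f ms)
           ([c, g, e, h] @ f)
       \<and> saalschutzian
           ([- of_nat n, d, a + lam, b + lam, \<mu> + 1] @ map (\<lambda>z. z + 1) zs)
           ([g + lam, e + lam, c, \<mu>] @ zs)"
proof -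
  define K where "K = of_nat n * d * (h + lam) + h * (g + lam - 1) * (e + lam - 1)"
  define R where "R = lam * (h - g + 1) - (g + of_nat n - 1) * (g - d - 1)"
  define as where "as = map2 (\<lambda>x j. x + of_nat j) f ms"
  \<comment> \<open>The left side pairs the coefficients of \<open>A\<close>, built from
    \<open>a\<close>, \<open>b\<close>, \<open>c\<close>, \<open>f\<close> and \<open>ms\<close>,
    with weights \<open>w\<close> that carry all other parameters.\<close>
  define A where "A = fps_hypergeo ([a, b] @ as) (c # f) 1"
  define B where "B = fps_hypergeo [lam] [] 1 * A"
  define w where "w k = pochhammer (- of_nat n) k * pochhammer d k * pochhammer (h + 1) k /
        (pochhammer g k * pochhammer e k * pochhammer h k)" for k
  have len: "length f = length ms" using assms(1,2) by simp
  have notin: "c \<notin> \<int>\<^sub>\<le>\<^sub>0" "g \<notin> \<int>\<^sub>\<le>\<^sub>0" "e \<notin> \<int>\<^sub>\<le>\<^sub>0" "h \<notin> \<int>\<^sub>\<le>\<^sub>0" "set f \<inter> \<int>\<^sub>\<le>\<^sub>0 = {}"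
    "g + lam \<notin> \<int>\<^sub>\<le>\<^sub>0" "e + lam \<notin> \<int>\<^sub>\<le>\<^sub>0" "\<mu> \<notin> \<int>\<^sub>\<le>\<^sub>0" "set zs \<inter> \<int>\<^sub>\<le>\<^sub>0 = {}"
    using lower_left lower_right by auto
  have n0: "n \<noteq> 0 \<or> g + lam \<noteq> 1 \<and> e + lam \<noteq> 1"
    using denom_Omega by blast
  have cab: "c - a - of_nat m = b + lam" "c - b - of_nat m = a + lam"
    by (simp_all add: lam)
  have B: "fps_nth B j = pochhammer (b + lam) j * pochhammer (a + lam) j / (pochhammer c j * fact j) *
      poly Q (- of_nat j)" for j
    using miller_paris_nth[OF len notin(5) assms(3) notin(1) assms(6,7), of j]
    unfolding Q cab lam[symmetric] by (simp only: B_def A_def as_def)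
  \<comment> \<open>The constant coefficient normalizes \<open>Q\<close> to the value 1 at 0, so no
    leading coefficient survives in \<open>BQ\<close>.\<close>
  have "fps_nth B 0 = 1"
  proof -
    have "foldl (\<lambda>r _. r) x xs = x" for x :: complex and xs :: "complex list"
      by (induction xs) simp_all
    then show ?thesis
      by (simp add: B_def A_def)
  qed
  then have Q0: "poly Q 0 = 1"
    using B[of 0] by simp
  have BQ: "fps_nth B j = pochhammer (b + lam) j * pochhammer (a + lam) j / (pochhammer c j * fact j) *
      ((\<Prod>z\<leftarrow>map (\<lambda>z. z + 1) zs. pochhammer z j) / (\<Prod>z\<leftarrow>zs. pochhammer z j))" for j
  proof -
    have "(\<Prod>z\<leftarrow>zs. pochhammer z j) \<noteq> 0"
      using notin(9) by (auto simp: prod_list_zero_iff disjoint_iff pochhammer_nonzero)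
    with poly_proots_shift[OF zeros, of j]
    have "poly Q (- of_nat j) =
        (\<Prod>z\<leftarrow>map (\<lambda>z. z + 1) zs. pochhammer z j) / (\<Prod>z\<leftarrow>zs. pochhammer z j)"
      unfolding Q0 mult_1_left by (rule eq_divide_imp[rotated])
    then show ?thesis
      unfolding B by (rule arg_cong)
  qed
  \<comment> \<open>Inverting the power of \<open>1 - X\<close> recovers \<open>A\<close> from
    \<open>B\<close>, whose coefficients are known.\<close>
  have "fps_hypergeo [lam] [] 1 * fps_hypergeo [- lam] [] 1 = 1"
    by (simp only: fps_hypergeo_power_add right_minus fps_hypergeo_power_0)
  moreover have "B * fps_hypergeo [- lam] [] 1 = fps_hypergeo [lam] [] 1 * fps_hypergeo [- lam] [] 1 * A"
    by (simp only: B_def mult_ac)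
  ultimately have A: "A = B * fps_hypergeo [- lam] [] 1"
    by (simp only: mult_1_left)
  have "R \<noteq> 0" and \<mu>: "\<mu> = K / R"
    using denom_mu unfolding mu K_def R_def by blast+
  then have KR: "K = \<mu> * R"
    by simp
  have "\<mu> \<noteq> 0"
    using notin(8) by auto
  \<comment> \<open>As \<open>K = \<mu> * R\<close>, the affine factor is
    \<open>K * (\<mu> + j) / \<mu>\<close>, the source of the parameter pair
    \<open>\<mu> + 1\<close> over \<open>\<mu>\<close>.\<close>
  then have K: "K + of_nat j * R = K * (pochhammer (\<mu> + 1) j / pochhammer \<mu> j)" for j
    unfolding pochhammer_plus_1_quotient[OF notin(8)] unfolding KR by (simp, simp add: algebra_simps)
  have "hypergeo1 ([- of_nat n, a, b, d, h + 1] @ as) ([c, g, e, h] @ f) = (\<Sum>k\<le>n. fps_nth A k * w k)"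
    unfolding append_Cons append_Nil hypergeo1_terminating
  proof (intro sum.cong refl)
    fix k
    have A_nth: "fps_nth A k = pochhammer a k * pochhammer b k * (\<Prod>x\<leftarrow>as. pochhammer x k) /
        (pochhammer c k * (\<Prod>x\<leftarrow>f. pochhammer x k) * fact k)"
      unfolding A_def by (simp add: foldl_mult_pochhammer)
    show "pochhammer (- of_nat n) k * (\<Prod>x\<leftarrow>a # b # d # (h + 1) # as. pochhammer x k) /
        ((\<Prod>x\<leftarrow>c # g # e # h # f. pochhammer x k) * fact k) = fps_nth A k * w k"
      unfolding A_nth w_def by (simp add: mult_ac)
  qed
  \<comment> \<open>The coefficients of \<open>(1 - X)^lam\<close> are \<open>(-lam)_i / i!\<close>;
    the outer index is already that of the right-hand series.\<close>
  also have "\<dots> = (\<Sum>j\<le>n. fps_nth B j * (\<Sum>i\<le>n - j. pochhammer (- lam) i / fact i * w (j + i)))"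
    unfolding A sum_fps_mult_nth by simp
  also have "\<dots> = (\<Sum>j\<le>n. \<Omega> * (pochhammer (- of_nat n) j *
      (\<Prod>x\<leftarrow>[d, a + lam, b + lam, \<mu> + 1] @ map (\<lambda>z. z + 1) zs. pochhammer x j) /
      ((\<Prod>x\<leftarrow>[g + lam, e + lam, c, \<mu>] @ zs. pochhammer x j) * fact j)))"
  proof (intro sum.cong refl)
    fix j assume "j \<in> {..n}"
    then have j: "j \<le> n" by simp
    show "fps_nth B j * (\<Sum>i\<le>n - j. pochhammer (- lam) i / fact i * w (j + i)) =
      \<Omega> * (pochhammer (- of_nat n) j *
      (\<Prod>x\<leftarrow>[d, a + lam, b + lam, \<mu> + 1] @ map (\<lambda>z. z + 1) zs. pochhammer x j) /
      ((\<Prod>x\<leftarrow>[g + lam, e + lam, c, \<mu>] @ zs. pochhammer x j) * fact j))"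
      unfolding BQ w_def saalschuetz_linear_factor_tail[OF notin(2-4,6,7) assms(8) n0 j]
      unfolding K_def[symmetric] R_def[symmetric] K Omega
      by (simp add: mult_ac)
  qed
  also have "\<dots> = \<Omega> * hypergeo1
           ([- of_nat n, d, a + lam, b + lam, \<mu> + 1] @ map (\<lambda>z. z + 1) zs)
           ([g + lam, e + lam, c, \<mu>] @ zs)"
    unfolding append_Cons append_Nil hypergeo1_terminating sum_distrib_left ..
  finally have main: "hypergeo1 ([- of_nat n, a, b, d, h + 1] @ as) ([c, g, e, h] @ f) = \<Omega> * hypergeo1
           ([- of_nat n, d, a + lam, b + lam, \<mu> + 1] @ map (\<lambda>z. z + 1) zs)
           ([g + lam, e + lam, c, \<mu>] @ zs)" .
  \<comment> \<open>Exactness of the degree enters here: \<open>m\<close> zeros raised by 1 add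
    \<open>m\<close> to the upper sum, as the shifts of \<open>f\<close> do on the left.\<close>
  have "length zs = m"
    using size_proots_complex[of Q] by (metis assms(12) size_mset zeros)
  then have "sum_list (map (\<lambda>z. z + 1) zs) = sum_list zs + of_nat m"
    by (simp add: sum_list_addf sum_list_triv)
  moreover have "sum_list as = sum_list f + of_nat m"
    unfolding as_def assms(3) by (rule sum_list_shift[OF len])
  ultimately have "saalschutzian ([- of_nat n, a, b, d, h + 1] @ as) ([c, g, e, h] @ f)"
    "saalschutzian ([- of_nat n, d, a + lam, b + lam, \<mu> + 1] @ map (\<lambda>z. z + 1) zs)
           ([g + lam, e + lam, c, \<mu>] @ zs)"
    using assms(8) by (simp_all add: saalschutzian_def lam algebra_simps)
  with main show ?thesis
    by (simp only: as_def)
qed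

end
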